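(* Let $V\subseteq\mathcal V$ be finite, $\mathbb E\in\mathit{NProg}(V)$, $W\subseteq\mathcal V$ finite, $P,Q$ projectors on $\mathcal H_W$, and $xp^p\in\{wp^p,wlp^p\}$. Then: (1) $sp^p.\mathbb E.(wlp^p.\mathbb E.Q)\sqsubseteq Q$ and $P\sqsubseteq wlp^p.\mathbb E.(sp^p.\mathbb E.P)$; (2) $wp^p.\mathbb E.Q=wlp^p.\mathbb E.Q\wedge wp^p.\mathbb E.I_W$; (3) $wp^p.\mathbb E.0=sp^p.\mathbb E.0=0$ and $wlp^p.\mathbb E.I_W=I_W$; (4) if $P\sqsubseteq Q$ then $xp^p.\mathbb E.P\sqsubseteq xp^p.\mathbb E.Q$ and $sp^p.\mathbb E.P\sqsubseteq sp^p.\mathbb E.Q$; (5) $xp^p.\mathbb E.(P\wedge Q)=xp^p.\mathbb E.P\wedge xp^p.\mathbb E.Q$; (6) $sp^p.\mathbb E.(P\wedge Q)\sqsubseteq sp^p.\mathbb E.P\wedge sp^p.\mathbb E.Q$; (7) $xp^p.\mathbb E.P\vee xp^p.\mathbb E.Q\sqsubseteq xp^p.\mathbb E.(P\vee Q)$; (8) $sp^p.\mathbb E.P\vee sp^p.\mathbb E.Q=sp^p.\mathbb E.(P\vee Q)$; (9) if $R$ is a projector on $\mathcal H_{W'}$ with $W'$ finite and $W'\cap(V\cup W)=\emptyset$, then $wp^p.\mathbb E.(Q\otimes R)=(wp^p.\mathbb E.Q)\otimes R$, $sp^p.\mathbb E.(P\otimes R)=(sp^p.\mathbb E.P)\otimes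 R$, and $wlp^p.\mathbb E.(Q\otimes R)\sqsupseteq(wlp^p.\mathbb E.Q)\otimes R$.
   Context: $\mathcal V$ is a countably infinite set of qubit variables; $\mathcal H_V=\bigotimes_{q\in V}\mathcal H_q$ with identity $I_V$. $\mathcal D(\mathcal H)$: partial density operators; projectors are identified with their image subspaces, ordered by inclusion $\sqsubseteq$; $\wedge$ intersection, $\vee$ span of union. $\mathit{DProg}(V)$: completely positive trace-nonincreasing super-operators on $\mathcal L(\mathcal H_V)$; $\mathit{NProg}(V)$: nonempty convex closed subsets of $\mathit{DProg}(V)$. Convention: operators/super-operators on subsystems are implicitly extended to larger systems by tensoring with identities; the transformers of a projector on a system $U$ are regarded as projectors on $\mathcal H_{V\cup U}$. For projectors $P,Q$ on $\mathcal H_U$: $\mathbb E\models_{tot}(\{P\},\{Q\})$ iff for all finite $X\supseteq V\cup U$ and $\rho\in\mathcal D(\mathcal H_X)$, ${\rm tr}(P\rho)\le\inf_{\mathcal E\in\mathbb E}{\rm tr}(Q\mathcal E(\rho))$; $\mathbb E\models_{par}(\{P\},\{Q\})$ iff for all such $X,\rho$, ${\rm tr}(P\rho)\le\inf_{\mathcal E\in\mathbb E}[{\rm tr}(Q\mathcal E(\rho))+{\rm tr}(\rho)-{\rm tr}(\mathcal E(\rho))]$. $wp^p.\mathbb E.Q$ is the largest projector $P$ with $\mathbb E\models_{tot}(\{P\},\{Q\})$; $wlp^p.\mathbb E.Q$ the largest projector $P$ with $\mathbb E\models_{par}(\{P\},\{Q\})$; $sp^p.\mathbb E.P$ the smallest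 projector $R$ with $\mathbb E\models_{par}(\{P\},\{R\})$. *)

theory Defs
  imports Complex_Main
begin

text \<open>Qubit variables are natural numbers. A computational basis state of the
register X (finite) is an assignment nat => bool that is False outside X.
Operators on H_X are matrices indexed by such basis states, represented as
functions asg => asg => complex that vanish outside the basis of X.\<close>

type_synonym asg = "nat \<Rightarrow> bool"
type_synonym op = "asg \<Rightarrow> asg \<Rightarrow> complex"
type_synonym sop = "op \<Rightarrow> op"

definition B :: "nat set \<Rightarrow> asg set" where
  "B X = {f. \<forall>q. q \<notin> X \<longrightarrow> \<not> f q}"

definition restr :: "nat set \<Rightarrow> asg \<Rightarrow> asg" where
  "restr X f = (\<lambda>q. if q \<in> X then f q else False)"

definition merge :: "nat set \<Rightarrow> asg \<Rightarrow> asg \<Rightarrow> asg" where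
  "merge X f g = (\<lambda>q. if q \<in> X then f q else g q)"

definition zop :: op where
  "zop = (\<lambda>_ _. 0)"

definition is_op :: "nat set \<Rightarrow> op \<Rightarrow> bool" where
  "is_op X A \<longleftrightarrow> (\<forall>f g. (f \<notin> B X \<or> g \<notin> B X) \<longrightarrow> A f g = 0)"

definition is_vec :: "nat set \<Rightarrow> (asg \<Rightarrow> complex) \<Rightarrow> bool" where
  "is_vec X v \<longleftrightarrow> (\<forall>f. f \<notin> B X \<longrightarrow> v f = 0)"

definition mult :: "nat set \<Rightarrow> op \<Rightarrow> op \<Rightarrow> op" where
  "mult X A C = (\<lambda>f g. \<Sum>h\<in>B X. A f h * C h g)"

definition app :: "nat set \<Rightarrow> op \<Rightarrow> (asg \<Rightarrow> complex) \<Rightarrow> (asg \<Rightarrow> complex)" where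
  "app X A v = (\<lambda>f. \<Sum>g\<in>B X. A f g * v g)"

definition adj :: "op \<Rightarrow> op" where
  "adj A = (\<lambda>f g. cnj (A g f))"

definition tr :: "nat set \<Rightarrow> op \<Rightarrow> complex" where
  "tr X A = (\<Sum>f\<in>B X. A f f)"

definition idop :: "nat set \<Rightarrow> op" where
  "idop X = (\<lambda>f g. if f \<in> B X \<and> f = g then 1 else 0)"

text \<open>Implicit extension A \<otimes> I_{X-U} of an operator A on H_U to H_X (U \<subseteq> X).\<close>
definition ext :: "nat set \<Rightarrow> nat set \<Rightarrow> op \<Rightarrow> op" where
  "ext U X A = (\<lambda>f g. if f \<in> B X \<and> g \<in> B X \<and> (\<forall>q\<in>X - U. f q = g q)
                      then A (restr U f) (restr U g) else 0)"

definition tensor :: "nat set \<Rightarrow> nat set \<Rightarrow> op \<Rightarrow> op \<Rightarrow> op" where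
  "tensor X Y A C = (\<lambda>f g. if f \<in> B (X \<union> Y) \<and> g \<in> B (X \<union> Y)
                      then A (restr X f) (restr X g) * C (restr Y f) (restr Y g) else 0)"

text \<open>Implicit extension E \<otimes> id_{X-V} of a super-operator E on L(H_V) to L(H_X).\<close>
definition sext :: "nat set \<Rightarrow> nat set \<Rightarrow> sop \<Rightarrow> sop" where
  "sext V X E \<rho> = (\<lambda>f g. if f \<in> B X \<and> g \<in> B X then
      E (\<lambda>f' g'. if f' \<in> B V \<and> g' \<in> B V then \<rho> (merge V f' f) (merge V g' g) else 0)
        (restr V f) (restr V g) else 0)"

definition psd :: "nat set \<Rightarrow> op \<Rightarrow> bool" where
  "psd X A \<longleftrightarrow> is_op X A \<and>
     (\<forall>v. let z = (\<Sum>f\<in>B X. \<Sum>g\<in>B X. cnj (v f) * A f g * v g) in Im z = 0 \<and> Re z \<ge> 0)"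

definition density :: "nat set \<Rightarrow> op \<Rightarrow> bool" where
  "density X \<rho> \<longleftrightarrow> psd X \<rho> \<and> Re (tr X \<rho>) \<le> 1"

definition proj :: "nat set \<Rightarrow> op \<Rightarrow> bool" where
  "proj X P \<longleftrightarrow> is_op X P \<and> mult X P P = P \<and> adj P = P"

definition rng :: "nat set \<Rightarrow> op \<Rightarrow> (asg \<Rightarrow> complex) set" where
  "rng X A = {app X A v | v. is_vec X v}"

definition vspan :: "(asg \<Rightarrow> complex) set \<Rightarrow> (asg \<Rightarrow> complex) set" where
  "vspan S = {v. \<exists>F c. finite F \<and> F \<subseteq> S \<and> v = (\<lambda>f. \<Sum>u\<in>F. c u * u f)}"

definition psub :: "nat set \<Rightarrow> op \<Rightarrow> op \<Rightarrow> bool" where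
  "psub X P Q \<longleftrightarrow> rng X P \<subseteq> rng X Q"

definition pmeet :: "nat set \<Rightarrow> op \<Rightarrow> op \<Rightarrow> op" where
  "pmeet X P Q = (THE R. proj X R \<and> rng X R = rng X P \<inter> rng X Q)"

definition pjoin :: "nat set \<Rightarrow> op \<Rightarrow> op \<Rightarrow> op" where
  "pjoin X P Q = (THE R. proj X R \<and> rng X R = vspan (rng X P \<union> rng X Q))"

text \<open>DProg(V): completely positive trace-nonincreasing super-operators on L(H_V)
(canonically zero on non-operators of H_V).\<close>
definition DProg :: "nat set \<Rightarrow> sop \<Rightarrow> bool" where
  "DProg V E \<longleftrightarrow>
     (\<forall>A. \<not> is_op V A \<longrightarrow> E A = zop) \<and>
     (\<forall>A. is_op V (E A)) \<and>
     (\<forall>A C. is_op V A \<longrightarrow> is_op V C \<longrightarrow>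
        E (\<lambda>f g. A f g + C f g) = (\<lambda>f g. E A f g + E C f g)) \<and>
     (\<forall>A c. is_op V A \<longrightarrow> E (\<lambda>f g. c * A f g) = (\<lambda>f g. c * E A f g)) \<and>
     (\<forall>X. finite X \<and> V \<subseteq> X \<longrightarrow> (\<forall>\<rho>. psd X \<rho> \<longrightarrow> psd X (sext V X E \<rho>))) \<and>
     (\<forall>\<rho>. psd V \<rho> \<longrightarrow> Re (tr V (E \<rho>)) \<le> Re (tr V \<rho>))"

definition NProg :: "nat set \<Rightarrow> sop set \<Rightarrow> bool" where
  "NProg V S \<longleftrightarrow> S \<noteq> {} \<and> (\<forall>E\<in>S. DProg V E) \<and>
     (\<forall>E1\<in>S. \<forall>E2\<in>S. \<forall>t::real. 0 \<le> t \<and> t \<le> 1 \<longrightarrow>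
        (\<lambda>A f g. complex_of_real t * E1 A f g + complex_of_real (1 - t) * E2 A f g) \<in> S) \<and>
     (\<forall>Es E. (\<forall>n. Es n \<in> S) \<and> (\<forall>A f g. (\<lambda>n. Es n A f g) \<longlonglongrightarrow> E A f g) \<longrightarrow> E \<in> S)"

definition sat_tot :: "sop set \<Rightarrow> nat set \<Rightarrow> nat set \<Rightarrow> op \<Rightarrow> nat set \<Rightarrow> op \<Rightarrow> bool" where
  "sat_tot S V U1 P U2 Q \<longleftrightarrow>
    (\<forall>X \<rho>. finite X \<and> V \<union> U1 \<union> U2 \<subseteq> X \<and> density X \<rho> \<longrightarrow>
       Re (tr X (mult X (ext U1 X P) \<rho>))
         \<le> (INF E\<in>S. Re (tr X (mult X (ext U2 X Q) (sext V X E \<rho>)))))"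

definition sat_par :: "sop set \<Rightarrow> nat set \<Rightarrow> nat set \<Rightarrow> op \<Rightarrow> nat set \<Rightarrow> op \<Rightarrow> bool" where
  "sat_par S V U1 P U2 Q \<longleftrightarrow>
    (\<forall>X \<rho>. finite X \<and> V \<union> U1 \<union> U2 \<subseteq> X \<and> density X \<rho> \<longrightarrow>
       Re (tr X (mult X (ext U1 X P) \<rho>))
         \<le> (INF E\<in>S. Re (tr X (mult X (ext U2 X Q) (sext V X E \<rho>)))
                     + Re (tr X \<rho>) - Re (tr X (sext V X E \<rho>))))"

definition wp :: "sop set \<Rightarrow> nat set \<Rightarrow> nat set \<Rightarrow> op \<Rightarrow> op" where
  "wp S V U Q = (THE P. proj (V \<union> U) P \<and> sat_tot S V (V \<union> U) P U Q \<and>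
      (\<forall>P'. proj (V \<union> U) P' \<and> sat_tot S V (V \<union> U) P' U Q \<longrightarrow> psub (V \<union> U) P' P))"

definition wlp :: "sop set \<Rightarrow> nat set \<Rightarrow> nat set \<Rightarrow> op \<Rightarrow> op" where
  "wlp S V U Q = (THE P. proj (V \<union> U) P \<and> sat_par S V (V \<union> U) P U Q \<and>
      (\<forall>P'. proj (V \<union> U) P' \<and> sat_par S V (V \<union> U) P' U Q \<longrightarrow> psub (V \<union> U) P' P))"

definition sp :: "sop set \<Rightarrow> nat set \<Rightarrow> nat set \<Rightarrow> op \<Rightarrow> op" where
  "sp S V U P = (THE R. proj (V \<union> U) R \<and> sat_par S V U P (V \<union> U) R \<and>
      (\<forall>R'. proj (V \<union> U) R' \<and> sat_par S V U P (V \<union> U) R' \<longrightarrow> psub (V \<union> U) R R'))"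

end

theory Submission
  imports Defs
begin

text \<open>Write \<open>E\<^sup>*\<close> for the dual of a super-operator \<open>E\<close>, so that \<open>tr (A E(\<rho>)) = tr (E\<^sup>*(A) \<rho>)\<close>.
  Since \<open>0 \<le> E\<^sup>*(Q) \<le> I\<close>, total correctness of (P, Q) says that every \<open>E\<^sup>*(Q)\<close> acts as the
  identity on the range of P, and partial correctness that every \<open>E\<^sup>*(I - Q)\<close> vanishes there.
  Hence wp and wlp project onto the common fixed space and the common kernel of these operators.
  The kernel condition at v means that the range of \<open>E(|v><v|)\<close> lies in Q, which yields sp as the
  lower adjoint of wlp. The lattice laws follow from this adjunction together with
  \<open>E\<^sup>*(Q) v = v \<longleftrightarrow> E\<^sup>*(I - Q) v = 0 \<and> E\<^sup>*(I) v = v\<close>, and the tensor laws from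
  \<open>E\<^sup>*(A \<otimes> R) = E\<^sup>*(A) \<otimes> R\<close>.\<close>

section \<open>Basis states\<close>

text \<open>The transformers are defined by definite descriptions, so their existence is part of the
  work: each correctness condition cuts out a subspace, and \<open>proj_exists\<close> supplies its
  projector. Two features of the definitions must go before linear algebra applies. The infimum over
  programs splits into one condition per program, since effects keep the expectations above 0. The
  quantification over all finite registers collapses to the least one, since
  \<open>E\<^sup>*(A) P = P\<close> survives tensoring with an identity. No spectral decomposition
  is used: hermiticity comes from polarisation, and otherwise it suffices that a psd A with
  \<open><v, A v> = 0\<close> kills v. The asymmetry of the tensor laws comes from loss of trace.
  \<open>E\<^sup>*(I - Q \<otimes> R)\<close> equals
  \<open>E\<^sup>*(I) \<otimes> I - E\<^sup>*(Q) \<otimes> R\<close>, which can also vanish outside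
  the range of \<open>I \<otimes> R\<close> where \<open>E\<^sup>*(I)\<close> vanishes; for E = 0 it
  vanishes everywhere. For wp, the fixed-point equation itself forces membership in
  \<open>I \<otimes> R\<close>.\<close>

lemma finite_B: "finite X \<Longrightarrow> finite (B X)"
proof -
  assume "finite X"
  have "B X \<subseteq> (\<lambda>A q. q \<in> A) ` Pow X"
  proof
    fix f assume "f \<in> B X"
    then have "{q. f q} \<in> Pow X" by (auto simp: B_def)
    moreover have "f = (\<lambda>q. q \<in> {q. f q})" by simp
    ultimately show "f \<in> (\<lambda>A q. q \<in> A) ` Pow X" by blast
  qed
  then show ?thesis by (rule finite_subset) (simp add: \<open>finite X\<close>)
qed

lemma restr_in_B [simp]: "restr X f \<in> B X"
  by (auto simp: restr_def B_def)

lemma restr_eq_self: "f \<in> B X \<Longrightarrow> restr X f = f"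
  by (auto simp: restr_def B_def)

lemma restr_restr: "Y \<subseteq> X \<Longrightarrow> restr Y (restr X f) = restr Y f"
  by (auto simp: restr_def fun_eq_iff)

lemma merge_in_B: "a \<in> B X \<Longrightarrow> b \<in> B Y \<Longrightarrow> merge X a b \<in> B (X \<union> Y)"
  by (auto simp: merge_def B_def)

lemma restr_merge1: "a \<in> B X \<Longrightarrow> restr X (merge X a b) = a"
  by (auto simp: restr_def merge_def B_def fun_eq_iff)

lemma restr_merge2: "b \<in> B Y \<Longrightarrow> X \<inter> Y = {} \<Longrightarrow> restr Y (merge X a b) = b"
  by (auto simp: restr_def merge_def B_def fun_eq_iff)

lemma merge_restr: "f \<in> B (X \<union> Y) \<Longrightarrow> merge X (restr X f) (restr Y f) = f"
  by (auto simp: restr_def merge_def B_def fun_eq_iff)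

lemma merge_merge: "merge X a (merge X c b) = merge X a b"
  by (auto simp: merge_def fun_eq_iff)

lemma bij_merge:
  assumes "X \<inter> Y = {}"
  shows "bij_betw (\<lambda>(a, b). merge X a b) (B X \<times> B Y) (B (X \<union> Y))"
  using assms
  by (intro bij_betw_byWitness[where f' = "\<lambda>f. (restr X f, restr Y f)"])
    (auto simp: restr_merge1 restr_merge2 merge_restr merge_in_B)

lemma sum_B_Un:
  assumes "X \<inter> Y = {}"
  shows "(\<Sum>f\<in>B (X \<union> Y). F f) = (\<Sum>a\<in>B X. \<Sum>b\<in>B Y. F (merge X a b))"
  using sum.reindex_bij_betw[OF bij_merge[OF assms], of F]
  by (simp add: sum.cartesian_product case_prod_unfold)

lemma B_Un_cases:
  assumes "f \<in> B (X \<union> Y)"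
  obtains a b where "a \<in> B X" "b \<in> B Y" "f = merge X a b"
  using merge_restr[OF assms] restr_in_B by metis

section \<open>Matrix algebra\<close>

lemma is_op_idop [simp]: "is_op X (idop X)"
  by (auto simp: is_op_def idop_def)

lemma is_op_zop [simp]: "is_op X zop"
  by (auto simp: is_op_def zop_def)

lemma is_op_diff: "is_op X A \<Longrightarrow> is_op X C \<Longrightarrow> is_op X (A - C)"
  by (auto simp: is_op_def)

lemma is_op_mult: "is_op X A \<Longrightarrow> is_op X C \<Longrightarrow> is_op X (mult X A C)"
  by (auto simp: is_op_def mult_def)

lemma is_op_adj: "is_op X A \<Longrightarrow> is_op X (adj A)"
  by (auto simp: is_op_def adj_def)

lemma is_vec_app: "is_op X A \<Longrightarrow> is_vec X (app X A v)"
  by (auto simp: is_op_def is_vec_def app_def)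

lemma op_eqI:
  assumes "is_op X A" "is_op X C" "\<And>f g. f \<in> B X \<Longrightarrow> g \<in> B X \<Longrightarrow> A f g = C f g"
  shows "A = C"
  using assms unfolding is_op_def fun_eq_iff by metis

lemma vec_eqI:
  assumes "is_vec X u" "is_vec X v" "\<And>f. f \<in> B X \<Longrightarrow> u f = v f"
  shows "u = v"
  using assms unfolding is_vec_def fun_eq_iff by metis

lemma mult_assoc: "mult X (mult X A C) D = mult X A (mult X C D)"
proof (intro ext)
  fix f g
  have "mult X (mult X A C) D f g = (\<Sum>h\<in>B X. \<Sum>k\<in>B X. A f k * C k h * D h g)"
    by (simp add: mult_def sum_distrib_right)
  also have "\<dots> = (\<Sum>k\<in>B X. \<Sum>h\<in>B X. A f k * C k h * D h g)" by (rule sum.swap)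
  also have "\<dots> = mult X A (mult X C D) f g"
    by (simp add: mult_def sum_distrib_left mult.assoc)
  finally show "mult X (mult X A C) D f g = mult X A (mult X C D) f g" .
qed

lemma app_mult: "app X (mult X A C) v = app X A (app X C v)"
proof
  fix f
  have "app X (mult X A C) v f = (\<Sum>h\<in>B X. \<Sum>k\<in>B X. A f k * C k h * v h)"
    by (simp add: mult_def app_def sum_distrib_right)
  also have "\<dots> = (\<Sum>k\<in>B X. \<Sum>h\<in>B X. A f k * C k h * v h)" by (rule sum.swap)
  also have "\<dots> = app X A (app X C v) f"
    by (simp add: app_def sum_distrib_left mult.assoc)
  finally show "app X (mult X A C) v f = app X A (app X C v) f" .
qed

lemma tr_mult_commute: "tr X (mult X A C) = tr X (mult X C A)"
  unfolding tr_def mult_def by (subst sum.swap) (simp add: mult.commute)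

lemma tr_diff: "tr X (A - C) = tr X A - tr X C"
  by (simp add: tr_def sum_subtractf)

lemma mult_diff_left: "mult X (A - C) D = mult X A D - mult X C D"
  by (simp add: fun_eq_iff mult_def sum_subtractf left_diff_distrib)

lemma mult_diff_right: "mult X D (A - C) = mult X D A - mult X D C"
  by (simp add: fun_eq_iff mult_def sum_subtractf right_diff_distrib)

lemma app_diff_op: "app X (A - C) v = app X A v - app X C v"
  by (simp add: fun_eq_iff app_def sum_subtractf left_diff_distrib)

lemma app_diff: "app X A (u - v) = app X A u - app X A v"
  by (simp add: fun_eq_iff app_def sum_subtractf right_diff_distrib)

lemma app_scale: "app X A (\<lambda>f. c * v f) = (\<lambda>f. c * app X A v f)"
  by (simp add: fun_eq_iff app_def sum_distrib_left mult_ac)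

lemma app_add: "app X A (\<lambda>f. u f + v f) = (\<lambda>f. app X A u f + app X A v f)"
  by (simp add: fun_eq_iff app_def sum.distrib distrib_left)

lemma app_zero [simp]: "app X A (\<lambda>_. 0) = (\<lambda>_. 0)"
  by (simp add: fun_eq_iff app_def)

lemma app_zop [simp]: "app X zop v = (\<lambda>_. 0)"
  by (simp add: fun_eq_iff app_def zop_def)

lemma adj_mult: "adj (mult X A C) = mult X (adj C) (adj A)"
  by (simp add: adj_def mult_def fun_eq_iff mult.commute)

lemma adj_adj [simp]: "adj (adj A) = A"
  by (simp add: adj_def)

lemma adj_diff: "adj (A - C) = adj A - adj C"
  by (simp add: adj_def fun_eq_iff)

lemma adj_idop [simp]: "adj (idop X) = idop X"
  unfolding adj_def idop_def by (intro ext) auto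

lemma idop_mult: "finite X \<Longrightarrow> is_op X A \<Longrightarrow> mult X (idop X) A = A"
proof (intro ext)
  fix f g assume *: "finite X" "is_op X A"
  have "mult X (idop X) A f g = (\<Sum>h\<in>B X. if h = f then A f g else 0)"
    unfolding mult_def by (intro sum.cong) (auto simp: idop_def)
  also have "\<dots> = A f g" using * by (auto simp: finite_B is_op_def)
  finally show "mult X (idop X) A f g = A f g" .
qed

lemma mult_idop: "finite X \<Longrightarrow> is_op X A \<Longrightarrow> mult X A (idop X) = A"
  using idop_mult[of X "adj A"] adj_mult[of X A "idop X"]
  by (metis adj_adj adj_idop is_op_adj)

lemma app_idop: "finite X \<Longrightarrow> is_vec X v \<Longrightarrow> app X (idop X) v = v"
proof
  fix f assume *: "finite X" "is_vec X v"
  have "app X (idop X) v f = (\<Sum>h\<in>B X. if h = f then v f else 0)"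
    unfolding app_def by (intro sum.cong) (auto simp: idop_def)
  also have "\<dots> = v f" using * by (auto simp: finite_B is_vec_def)
  finally show "app X (idop X) v f = v f" .
qed

section \<open>Inner product and rank-one operators\<close>

definition outer :: "(asg \<Rightarrow> complex) \<Rightarrow> (asg \<Rightarrow> complex) \<Rightarrow> op" where
  "outer u v = (\<lambda>f g. u f * cnj (v g))"

definition ip :: "nat set \<Rightarrow> (asg \<Rightarrow> complex) \<Rightarrow> (asg \<Rightarrow> complex) \<Rightarrow> complex" where
  "ip X u v = (\<Sum>f\<in>B X. cnj (u f) * v f)"

lemma is_op_outer: "is_vec X u \<Longrightarrow> is_vec X v \<Longrightarrow> is_op X (outer u v)"
  by (auto simp: is_vec_def is_op_def outer_def)

lemma ip_cnj: "cnj (ip X u v) = ip X v u"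
  by (simp add: ip_def mult.commute)

lemma ip_app: "ip X u (app X A v) = ip X (app X (adj A) u) v"
proof -
  have "ip X u (app X A v) = (\<Sum>f\<in>B X. \<Sum>g\<in>B X. cnj (u f) * A f g * v g)"
    by (simp add: ip_def app_def sum_distrib_left mult.assoc)
  also have "\<dots> = (\<Sum>g\<in>B X. \<Sum>f\<in>B X. cnj (u f) * A f g * v g)" by (rule sum.swap)
  also have "\<dots> = ip X (app X (adj A) u) v"
    by (simp add: ip_def app_def adj_def sum_distrib_left mult_ac)
  finally show ?thesis .
qed

lemma ip_diff_right: "ip X u (v - w) = ip X u v - ip X u w"
  by (simp add: ip_def sum_subtractf right_diff_distrib)

lemma ip_self: "ip X v v = complex_of_real (\<Sum>f\<in>B X. (cmod (v f))\<^sup>2)"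
  unfolding ip_def of_real_sum
  by (intro sum.cong) (auto simp: complex_norm_square mult.commute simp del: of_real_power)

lemma ip_self_nonneg: "Re (ip X v v) \<ge> 0"
  by (simp add: ip_self sum_nonneg)

lemma ip_self_eq_0:
  assumes "finite X" "is_vec X v" "ip X v v = 0"
  shows "v = (\<lambda>_. 0)"
proof
  fix f
  have "(\<Sum>f\<in>B X. (cmod (v f))\<^sup>2) = 0"
    using assms(3) unfolding ip_self of_real_eq_0_iff .
  then have "\<forall>f\<in>B X. (cmod (v f))\<^sup>2 = 0"
    using assms(1) by (subst (asm) sum_nonneg_eq_0_iff) (auto simp: finite_B)
  then show "v f = 0" using assms(2) by (cases "f \<in> B X") (auto simp: is_vec_def)
qed

lemma app_outer: "app X (outer u v) w = (\<lambda>f. ip X v w * u f)"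
  by (simp add: app_def outer_def ip_def fun_eq_iff sum_distrib_left mult_ac)

lemma mult_outer: "mult X A (outer u v) = outer (app X A u) v"
  by (simp add: mult_def outer_def app_def fun_eq_iff sum_distrib_right mult.assoc)

lemma tr_outer: "tr X (outer u v) = ip X v u"
  by (simp add: tr_def outer_def ip_def mult.commute)

section \<open>Positive semidefinite matrices\<close>

lemma psd_iff:
  "psd X A \<longleftrightarrow> is_op X A \<and> (\<forall>v. Im (ip X v (app X A v)) = 0 \<and> 0 \<le> Re (ip X v (app X A v)))"
  by (simp add: psd_def Let_def ip_def app_def sum_distrib_left mult.assoc)

lemma psd_is_op: "psd X A \<Longrightarrow> is_op X A"
  by (simp add: psd_def)

lemma psd_ip: "psd X A \<Longrightarrow> 0 \<le> Re (ip X v (app X A v))"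
  by (simp add: psd_iff)

lemma ip_app_add:
  "ip X (\<lambda>f. v f + c * w f) (app X A (\<lambda>f. v f + c * w f)) =
   ip X v (app X A v) + c * ip X v (app X A w) + cnj c * ip X w (app X A v)
   + c * cnj c * ip X w (app X A w)"
proof -
  have "app X A (\<lambda>f. v f + c * w f) = (\<lambda>f. app X A v f + c * app X A w f)"
    using app_add[of X A v "\<lambda>f. c * w f"] by (simp add: app_scale)
  then show ?thesis
    by (simp add: ip_def algebra_simps sum.distrib sum_distrib_left)
qed

text \<open>Polarisation: \<open>psd\<close> only says that the quadratic form is real and
  nonnegative. Its reality at v + w and at v + i w fixes the imaginary and the real part of the
  difference.\<close>

lemma psd_sesqui_herm:
  assumes "psd X A"
  shows "ip X w (app X A v) = cnj (ip X v (app X A w))"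
proof -
  let ?q = "\<lambda>v. ip X v (app X A v)"
  have q: "Im (?q v) = 0" for v using assms by (simp add: psd_iff)
  have "Im (ip X v (app X A w) + ip X w (app X A v)) = 0"
    using q[of "\<lambda>f. v f + 1 * w f"] unfolding ip_app_add[of X v 1 w A] by (simp add: q)
  moreover have "Re (ip X v (app X A w)) - Re (ip X w (app X A v)) = 0"
    using q[of "\<lambda>f. v f + \<i> * w f"] unfolding ip_app_add[of X v \<i> w A] by (simp add: q)
  ultimately show ?thesis by (simp add: complex_eq_iff)
qed

text \<open>For small positive t the linear term dominates, so a positive z would make the value
  negative.\<close>

lemma quadratic_nonneg_imp_zero:
  fixes z q :: real
  assumes "0 \<le> z" "\<And>t. 0 \<le> - 2 * t * z + t\<^sup>2 * z * q"
  shows "z = 0"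
proof (rule ccontr)
  assume "z \<noteq> 0"
  then have "0 < z" using assms(1) by simp
  \<comment> \<open>Small enough that t q < 2 for every q, and defined even for q = 0.\<close>
  define t where "t = 1 / (\<bar>q\<bar> + 1)"
  have t: "0 < t" "t * q < 2"
  proof -
    show "0 < t" by (simp add: t_def)
    have "t * q \<le> \<bar>q\<bar> / (\<bar>q\<bar> + 1)" by (simp add: t_def divide_right_mono)
    also have "\<dots> < 2" by (simp add: divide_less_eq)
    finally show "t * q < 2" .
  qed
  have "- 2 * t * z + t\<^sup>2 * z * q = t * z * (t * q - 2)"
    by (simp add: power2_eq_square algebra_simps)
  also have "\<dots> < 0" using t \<open>0 < z\<close> by (simp add: mult_pos_neg)
  finally show False using assms(2)[of t] by simp
qed

text \<open>At a zero v of the form, moving v in any direction w must not make the form negative, so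
  the term linear in the displacement vanishes. Hence \<open><v, A w> = 0\<close> for all w, and w =
  A v finishes. This takes the place of a square root of A.\<close>

lemma psd_kernel:
  assumes "finite X" "psd X A" "Re (ip X v (app X A v)) = 0"
  shows "app X A v = (\<lambda>_. 0)"
proof -
  have zero: "ip X v (app X A w) = 0" for w
  proof -
    define z where "z = ip X v (app X A w)"
    define q where "q = Re (ip X w (app X A w))"
    have h: "ip X w (app X A v) = cnj z"
      unfolding z_def by (rule psd_sesqui_herm[OF assms(2)])
    have "0 \<le> - 2 * t * (cmod z)\<^sup>2 + t\<^sup>2 * (cmod z)\<^sup>2 * q" for t
    proof -
      \<comment> \<open>The phase of c turns both cross terms into the same real number
        \<open>- t |z|^2\<close>.\<close>
      define c where "c = - complex_of_real t * cnj z"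
      have zz: "z * cnj z = complex_of_real ((cmod z)\<^sup>2)" by (simp add: complex_norm_square del: of_real_power)
      have "c * z = complex_of_real (- t * (cmod z)\<^sup>2)"
        using zz by (simp add: c_def mult_ac)
      moreover have "cnj c * cnj z = complex_of_real (- t * (cmod z)\<^sup>2)"
        using zz by (simp add: c_def mult_ac)
      moreover have "c * cnj c = complex_of_real (t\<^sup>2 * (cmod z)\<^sup>2)"
        using zz by (simp add: c_def mult_ac power2_eq_square)
      ultimately have "Re (ip X (\<lambda>f. v f + c * w f) (app X A (\<lambda>f. v f + c * w f))) =
          - 2 * t * (cmod z)\<^sup>2 + t\<^sup>2 * (cmod z)\<^sup>2 * q"
        unfolding ip_app_add h z_def[symmetric] by (simp add: assms(3) q_def)
      then show ?thesis using psd_ip[OF assms(2)] by metis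
    qed
    then have "(cmod z)\<^sup>2 = 0" by (rule quadratic_nonneg_imp_zero[rotated]) simp
    then show ?thesis by (simp add: z_def)
  qed
  have "ip X (app X A v) (app X A v) = 0"
    by (subst psd_sesqui_herm[OF assms(2)]) (simp add: zero)
  then show ?thesis
    using ip_self_eq_0 assms(1) is_vec_app psd_is_op assms(2) by blast
qed

lemma psd_outer:
  assumes "is_vec X v"
  shows "psd X (outer v v)"
proof -
  have "ip X w (app X (outer v v) w) = ip X v w * cnj (ip X v w)" for w
  proof -
    have "ip X w (app X (outer v v) w) = ip X v w * ip X w v"
      by (simp add: app_outer ip_def[of X w] sum_distrib_left mult_ac)
    then show ?thesis by (simp add: ip_cnj)
  qed
  then show ?thesis using assms by (simp add: psd_iff is_op_outer complex_mult_cnj flip: power2_eq_square)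
qed

lemma psd_conj:
  assumes "psd X A" "is_op X C"
  shows "psd X (mult X C (mult X A (adj C)))"
proof -
  have "ip X v (app X (mult X C (mult X A (adj C))) v) = ip X (app X (adj C) v) (app X A (app X (adj C) v))" for v
    by (simp add: app_mult ip_app[of X v C])
  then show ?thesis using assms by (auto simp: psd_iff is_op_mult is_op_adj)
qed

lemma ip_app_basis:
  assumes "finite X" "f \<in> B X" "g \<in> B X"
  shows "ip X (\<lambda>h. of_bool (h = f)) (app X A (\<lambda>h. of_bool (h = g))) = A f g"
proof -
  have "(\<Sum>h\<in>B X. A k h * of_bool (h = g)) = A k g" for k
    using assms sum.delta[OF finite_B[OF assms(1)], of g "A k"]
    by (simp add: of_bool_def if_distrib if_distribR cong: if_cong)
  then show ?thesis
    using assms sum.delta[OF finite_B[OF assms(1)], of f "\<lambda>h. A h g"]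
    by (simp add: ip_def app_def of_bool_def if_distrib if_distribR cong: if_cong)
qed

lemma psd_adj:
  assumes "finite X" "psd X A"
  shows "adj A = A"
proof (rule op_eqI[of X])
  fix f g assume "f \<in> B X" "g \<in> B X"
  then show "adj A f g = A f g"
    using psd_sesqui_herm[OF assms(2), of "\<lambda>h. of_bool (h = f)" "\<lambda>h. of_bool (h = g)"]
    by (simp add: ip_app_basis assms(1) adj_def)
qed (auto intro: is_op_adj psd_is_op[OF assms(2)])

lemma psd_tr:
  assumes "finite X" "psd X A"
  shows "Im (tr X A) = 0" "0 \<le> Re (tr X A)"
proof -
  have "Im (A f f) = 0 \<and> 0 \<le> Re (A f f)" if "f \<in> B X" for f
    using assms ip_app_basis[OF assms(1) that that, of A] unfolding psd_iff by metis
  then show "Im (tr X A) = 0" "0 \<le> Re (tr X A)" by (simp_all add: tr_def sum_nonneg)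
qed

lemma tr_mult_outer: "tr X (mult X A (outer v v)) = ip X v (app X A v)"
  by (simp add: mult_outer tr_outer)

section \<open>Projectors and subspaces\<close>

lemma proj_is_op: "proj X P \<Longrightarrow> is_op X P"
  by (simp add: proj_def)

lemma proj_idem: "proj X P \<Longrightarrow> app X P (app X P v) = app X P v"
  by (metis app_mult proj_def)

lemma rng_proj: "proj X P \<Longrightarrow> rng X P = {v. is_vec X v \<and> app X P v = v}"
  unfolding rng_def by (auto simp: proj_idem is_vec_app proj_is_op) metis

lemma proj_zop [simp]: "proj X zop"
  by (simp add: proj_def zop_def is_op_def mult_def adj_def)

lemma rng_zop [simp]: "rng X zop = {\<lambda>_. 0}"
  by (auto simp: rng_def is_vec_def)

lemma proj_idop [simp]: "finite X \<Longrightarrow> proj X (idop X)"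
  by (simp add: proj_def idop_mult)

lemma rng_idop: "finite X \<Longrightarrow> rng X (idop X) = {v. is_vec X v}"
  by (auto simp: rng_proj app_idop)

lemma psd_proj:
  assumes "proj X P"
  shows "psd X P"
proof -
  have "ip X v (app X P v) = ip X (app X P v) (app X P v)" for v
    using assms ip_app[of X v P "app X P v"] by (simp add: proj_def proj_idem[OF assms])
  then show ?thesis
    using assms by (simp add: psd_iff proj_def ip_self sum_nonneg del: of_real_sum)
qed

lemma proj_compl:
  assumes "finite X" "proj X P"
  shows "proj X (idop X - P)"
  using assms
  by (simp add: proj_def is_op_diff adj_diff mult_diff_left mult_diff_right idop_mult mult_idop fun_eq_iff)

lemma compl_compl: "idop X - (idop X - P) = P" for P :: op
  by (simp add: fun_eq_iff)

lemma rng_compl: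
  assumes "finite X" "proj X P"
  shows "rng X (idop X - P) = {v. is_vec X v \<and> app X P v = (\<lambda>_. 0)}"
proof -
  have "app X (idop X - P) v = v \<longleftrightarrow> app X P v = (\<lambda>_. 0)" if "is_vec X v" for v
    using app_idop[OF assms(1) that] by (auto simp: app_diff_op fun_eq_iff)
  then show ?thesis using rng_proj[OF proj_compl[OF assms]] by auto
qed

text \<open>A column of P is a column of P P, hence fixed by P. Through this, statements about all
  vectors of the range become operator identities such as \<open>M P = P\<close>.\<close>

lemma proj_column:
  assumes "proj X P"
  shows "(\<lambda>f. P f g) \<in> rng X P"
proof -
  have "app X P (\<lambda>f. P f g) = (\<lambda>f. mult X P P f g)" by (simp add: app_def mult_def)
  then show ?thesis using assms by (auto simp: rng_proj proj_def is_op_def is_vec_def)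
qed

lemma psub_mult_eq:
  assumes "proj X P" "proj X Q" "psub X P Q"
  shows "mult X Q P = P"
proof (intro ext)
  fix f g
  have "(\<lambda>f. P f g) \<in> rng X Q" using proj_column[OF assms(1)] assms(3) by (auto simp: psub_def)
  then have "app X Q (\<lambda>f. P f g) f = P f g" using assms(2) by (simp add: rng_proj)
  then show "mult X Q P f g = P f g" by (simp add: app_def mult_def)
qed

lemma psub_mult_eq':
  assumes "proj X P" "proj X Q" "psub X P Q"
  shows "mult X P Q = P"
proof -
  have "adj (mult X Q P) = adj P" using psub_mult_eq[OF assms] by simp
  then show ?thesis using assms by (simp add: adj_mult proj_def)
qed

lemma psub_antisym:
  assumes "proj X P" "proj X Q" "psub X P Q" "psub X Q P"
  shows "P = Q"
  using psub_mult_eq[OF assms(1-3)] psub_mult_eq'[OF assms(2,1,4)] by simp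

lemma proj_eqI: "proj X P \<Longrightarrow> proj X Q \<Longrightarrow> rng X P = rng X Q \<Longrightarrow> P = Q"
  by (simp add: psub_antisym psub_def)

lemma psub_refl [simp]: "psub X P P"
  by (simp add: psub_def)

lemma psub_compl:
  assumes "finite X" "proj X P" "proj X Q" "psub X P Q"
  shows "psub X (idop X - Q) (idop X - P)"
  unfolding psub_def
proof
  fix v assume "v \<in> rng X (idop X - Q)"
  then have v: "is_vec X v" "app X Q v = (\<lambda>_. 0)" using assms by (auto simp: rng_compl)
  have "app X P v = app X P (app X Q v)"
    using psub_mult_eq'[OF assms(2-4)] app_mult by metis
  then show "v \<in> rng X (idop X - P)" using v assms by (simp add: rng_compl)
qed

lemma psub_compl_iff:
  assumes "finite X" "proj X P" "proj X Q"
  shows "psub X (idop X - P) (idop X - Q) \<longleftrightarrow> psub X Q P"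
  using assms psub_compl[of X Q P]
    psub_compl[of X "idop X - P" "idop X - Q"] proj_compl by (auto simp: compl_compl)

section \<open>Subspaces and the projectors onto them\<close>

definition subsp :: "nat set \<Rightarrow> (asg \<Rightarrow> complex) set \<Rightarrow> bool" where
  "subsp X K \<longleftrightarrow> (\<forall>v\<in>K. is_vec X v) \<and> (\<lambda>_. 0) \<in> K \<and>
     (\<forall>u\<in>K. \<forall>v\<in>K. (\<lambda>f. u f + v f) \<in> K) \<and> (\<forall>c. \<forall>v\<in>K. (\<lambda>f. c * v f) \<in> K)"

lemma subsp_add: "subsp X K \<Longrightarrow> u \<in> K \<Longrightarrow> v \<in> K \<Longrightarrow> (\<lambda>f. u f + v f) \<in> K"
  by (auto simp: subsp_def)

lemma subsp_scale: "subsp X K \<Longrightarrow> v \<in> K \<Longrightarrow> (\<lambda>f. c * v f) \<in> K"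
  by (auto simp: subsp_def)

lemma subsp_sum:
  assumes "subsp X K" "finite F" "\<And>i. i \<in> F \<Longrightarrow> u i \<in> K"
  shows "(\<lambda>f. \<Sum>i\<in>F. c i * u i f) \<in> K"
  using assms(2,3)
proof (induction F rule: finite_induct)
  case empty
  then show ?case using assms(1) by (simp add: subsp_def)
next
  case (insert x F)
  have "(\<lambda>f. c x * u x f) \<in> K" "(\<lambda>f. \<Sum>i\<in>F. c i * u i f) \<in> K"
    using insert assms(1) by (auto simp: subsp_def)
  then have "(\<lambda>f. c x * u x f + (\<Sum>i\<in>F. c i * u i f)) \<in> K"
    by (rule subsp_add[OF assms(1)])
  then show ?case using insert by simp
qed

lemma subsp_rng: "proj X P \<Longrightarrow> subsp X (rng X P)"
  by (auto simp: subsp_def rng_proj app_add app_scale) (auto simp: is_vec_def)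

lemma subsp_Int: "subsp X K \<Longrightarrow> subsp X L \<Longrightarrow> subsp X (K \<inter> L)"
  by (auto simp: subsp_def)

lemma vspanE:
  assumes "v \<in> vspan K"
  obtains F c where "finite F" "F \<subseteq> K" "v = (\<lambda>f. \<Sum>u\<in>F. c u * u f)"
  using assms unfolding vspan_def by auto

lemma vspanI: "finite F \<Longrightarrow> F \<subseteq> K \<Longrightarrow> (\<lambda>f. \<Sum>u\<in>F. c u * u f) \<in> vspan K"
  unfolding vspan_def by auto

lemma subsp_vspan:
  assumes "\<And>v. v \<in> K \<Longrightarrow> is_vec X v"
  shows "subsp X (vspan K)"
  unfolding subsp_def
proof (intro conjI ballI allI)
  fix v assume "v \<in> vspan K"
  then show "is_vec X v"
    using assms by (auto simp: vspan_def is_vec_def intro!: sum.neutral)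
next
  show "(\<lambda>_. 0) \<in> vspan K" using vspanI[of "{}" K] by simp
next
  fix u v assume u: "u \<in> vspan K" and v: "v \<in> vspan K"
  obtain F c where F: "finite F" "F \<subseteq> K" "u = (\<lambda>f. \<Sum>x\<in>F. c x * x f)"
    using u by (rule vspanE)
  obtain G d where G: "finite G" "G \<subseteq> K" "v = (\<lambda>f. \<Sum>x\<in>G. d x * x f)"
    using v by (rule vspanE)
  \<comment> \<open>F and G may overlap, so both coefficients are extended by 0 to the union and
    added.\<close>
  define e where "e x = (if x \<in> F then c x else 0) + (if x \<in> G then d x else 0)" for x
  have "u f + v f = (\<Sum>x\<in>F \<union> G. e x * x f)" for f
  proof -
    have "(\<Sum>x\<in>F. c x * x f) = (\<Sum>x\<in>F \<union> G. (if x \<in> F then c x else 0) * x f)"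
      using F G by (intro sum.mono_neutral_cong_left) auto
    moreover have "(\<Sum>x\<in>G. d x * x f) = (\<Sum>x\<in>F \<union> G. (if x \<in> G then d x else 0) * x f)"
      using F G by (intro sum.mono_neutral_cong_left) auto
    ultimately show ?thesis by (simp add: F(3) G(3) e_def distrib_right sum.distrib)
  qed
  then show "(\<lambda>f. u f + v f) \<in> vspan K" using F G by (simp add: vspanI)
next
  fix k v assume "v \<in> vspan K"
  then obtain F c where F: "finite F" "F \<subseteq> K" "v = (\<lambda>f. \<Sum>x\<in>F. c x * x f)"
    by (rule vspanE)
  have "(\<lambda>f. k * v f) = (\<lambda>f. \<Sum>x\<in>F. (k * c x) * x f)"
    by (simp add: F(3) sum_distrib_left mult.assoc)
  then show "(\<lambda>f. k * v f) \<in> vspan K"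
    using F(1,2) by (simp add: vspanI)
qed

lemma vspan_superset: "K \<subseteq> vspan K"
proof
  fix v assume "v \<in> K"
  then show "v \<in> vspan K" using vspanI[of "{v}" K "\<lambda>_. 1"] by simp
qed

lemma vspan_minimal: "subsp X L \<Longrightarrow> K \<subseteq> L \<Longrightarrow> vspan K \<subseteq> L"
  by (auto elim!: vspanE intro!: subsp_sum[of X L _ "\<lambda>u. u"])

text \<open>One Gram-Schmidt step: some v in K is missed by P, its component w orthogonal to the
  range of P lies in K and is nonzero, and the projector onto the line of w is added to P. The trace
  counts the rank.\<close>

lemma proj_enlarge:
  assumes "finite X" "subsp X K" "proj X P" "rng X P \<subseteq> K" "rng X P \<noteq> K"
  shows "\<exists>P'. proj X P' \<and> rng X P' \<subseteq> K \<and> tr X P' = tr X P + 1"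
proof -
  obtain v where v: "v \<in> K" "v \<notin> rng X P" using assms(4,5) by blast
  have vv: "is_vec X v" using v assms(2) by (simp add: subsp_def)
  define w where "w = v - app X P v"
  have w: "is_vec X w" unfolding w_def
    using vv is_vec_app[OF proj_is_op[OF assms(3)], of v] by (auto simp: is_vec_def)
  have wK: "w \<in> K"
  proof -
    have "app X P v \<in> K" using assms(4) vv by (auto simp: rng_def)
    then have "(\<lambda>f. - 1 * app X P v f) \<in> K" by (rule subsp_scale[OF assms(2)])
    with v(1) have "(\<lambda>f. v f + - 1 * app X P v f) \<in> K" by (rule subsp_add[OF assms(2)])
    then show ?thesis by (simp add: w_def fun_diff_def)
  qed
  have Pw: "app X P w = (\<lambda>_. 0)" by (simp add: w_def app_diff proj_idem[OF assms(3)] fun_eq_iff)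
  have "w \<noteq> (\<lambda>_. 0)"
  proof
    assume "w = (\<lambda>_. 0)"
    then have "app X P v = v" by (auto simp: w_def fun_eq_iff)
    then show False using v vv assms(3) by (simp add: rng_proj)
  qed
  then have N: "ip X w w \<noteq> 0" using ip_self_eq_0[OF assms(1) w] by blast
  \<comment> \<open>With this factor \<open>c |w><w|\<close> is the projector onto the line of w and
    has trace 1.\<close>
  define c where "c = 1 / ip X w w"
  have cc: "cnj c = c" by (simp add: c_def ip_cnj)
  define P' :: op where "P' = (\<lambda>f g. P f g + c * (w f * cnj (w g)))"
  have wP: "(\<Sum>h\<in>B X. cnj (w h) * P h g) = 0" for g
  proof -
    have "(\<Sum>h\<in>B X. cnj (w h) * P h g) = cnj (app X (adj P) w g)"
      by (simp add: app_def adj_def mult.commute)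
    then show ?thesis using Pw assms(3) by (simp add: proj_def)
  qed
  have Pw': "(\<Sum>h\<in>B X. P f h * w h) = 0" for f using Pw by (simp add: app_def fun_eq_iff)
  have app': "app X P' u = (\<lambda>f. app X P u f + c * ip X w u * w f)" for u
  proof
    fix f
    have "app X P' u f = (\<Sum>g\<in>B X. P f g * u g + c * w f * (cnj (w g) * u g))"
      by (simp add: app_def P'_def ring_distribs mult_ac)
    also have "\<dots> = app X P u f + c * w f * ip X w u"
      by (simp add: app_def ip_def sum.distrib sum_distrib_left)
    finally show "app X P' u f = app X P u f + c * ip X w u * w f" by simp
  qed
  have "proj X P'"
    unfolding proj_def
  proof (intro conjI)
    show "is_op X P'" using proj_is_op[OF assms(3)] w by (auto simp: is_op_def P'_def is_vec_def)
    have "cnj (P g f) = P f g" for f g using assms(3) by (metis adj_def proj_def)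
    then show "adj P' = P'" by (simp add: adj_def P'_def cc mult_ac fun_eq_iff)
    show "mult X P' P' = P'"
    proof (intro ext)
      fix f g
      have "mult X P' P' f g = mult X P P f g + c * cnj (w g) * (\<Sum>h\<in>B X. P f h * w h)
          + c * w f * (\<Sum>h\<in>B X. cnj (w h) * P h g) + c * (c * ip X w w) * (w f * cnj (w g))"
      proof -
        have "mult X P' P' f g = (\<Sum>h\<in>B X. P f h * P h g + c * cnj (w g) * (P f h * w h)
            + c * w f * (cnj (w h) * P h g) + c * c * (w f * cnj (w g)) * (cnj (w h) * w h))"
          by (simp add: mult_def P'_def ring_distribs mult_ac add_ac)
        then show ?thesis by (simp add: mult_def ip_def sum.distrib sum_distrib_left[symmetric])
      qed
      also have "\<dots> = P' f g" using assms(3) N by (simp add: wP Pw' P'_def proj_def c_def)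
      finally show "mult X P' P' f g = P' f g" .
    qed
  qed
  moreover have "rng X P' \<subseteq> K"
  proof
    fix x assume "x \<in> rng X P'"
    then obtain u where u: "is_vec X u" "x = (\<lambda>f. app X P u f + c * ip X w u * w f)"
      unfolding rng_def app' by blast
    have "app X P u \<in> K" using assms(4) u by (auto simp: rng_def)
    moreover have "(\<lambda>f. c * ip X w u * w f) \<in> K" using wK by (rule subsp_scale[OF assms(2)])
    ultimately show "x \<in> K" unfolding u by (rule subsp_add[OF assms(2)])
  qed
  moreover have "tr X P' = tr X P + 1"
  proof -
    have "tr X P' = tr X P + c * ip X w w"
      by (simp add: tr_def P'_def sum.distrib ip_def sum_distrib_left mult_ac)
    then show ?thesis using N by (simp add: c_def)
  qed
  ultimately show ?thesis by blast
qed

text \<open>Start from the zero projector and enlarge it inside K. Every enlargement raises the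
  trace by 1, so the process must reach K before the trace exceeds the dimension
  \<open>card (B X)\<close>.\<close>

lemma proj_exists:
  assumes "finite X" "subsp X K"
  obtains P where "proj X P" "rng X P = K"
proof -
  have "(\<exists>P. proj X P \<and> rng X P = K) \<or> (\<exists>P. proj X P \<and> rng X P \<subseteq> K \<and> tr X P = of_nat n)" for n
  proof (induction n)
    case 0
    have "tr X zop = 0" by (simp add: tr_def zop_def)
    moreover have "rng X zop \<subseteq> K" using assms(2) by (simp add: subsp_def)
    ultimately show ?case using proj_zop by (metis of_nat_0)
  next
    case (Suc n)
    then show ?case using proj_enlarge[OF assms] by (metis of_nat_Suc add.commute)
  qed
  from this[of "Suc (card (B X))"] have "\<exists>P. proj X P \<and> rng X P = K"
  proof
    assume "\<exists>P. proj X P \<and> rng X P \<subseteq> K \<and> tr X P = of_nat (Suc (card (B X)))"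
    then obtain P where P: "proj X P" "tr X P = of_nat (Suc (card (B X)))" by blast
    \<comment> \<open>The complement of P is a projector as well, which bounds the trace of P by the
      dimension.\<close>
    have "0 \<le> Re (tr X (idop X - P))"
      by (rule psd_tr(2)[OF assms(1) psd_proj[OF proj_compl[OF assms(1) P(1)]]])
    moreover have "tr X (idop X) = of_nat (card (B X))" by (simp add: tr_def idop_def)
    ultimately show ?thesis using P by (simp add: tr_diff)
  qed
  then show thesis using that by blast
qed

section \<open>Meets and joins of projectors\<close>

lemma pmeet_props:
  assumes "finite X" "proj X P" "proj X Q"
  shows proj_pmeet: "proj X (pmeet X P Q)" and rng_pmeet: "rng X (pmeet X P Q) = rng X P \<inter> rng X Q"
proof -
  obtain R where "proj X R" "rng X R = rng X P \<inter> rng X Q"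
    using proj_exists[OF assms(1)] subsp_Int subsp_rng assms by metis
  then have "\<exists>!R. proj X R \<and> rng X R = rng X P \<inter> rng X Q" using proj_eqI by blast
  from theI'[OF this] show "proj X (pmeet X P Q)" "rng X (pmeet X P Q) = rng X P \<inter> rng X Q"
    unfolding pmeet_def by auto
qed

lemma pjoin_props:
  assumes "finite X" "proj X P" "proj X Q"
  shows proj_pjoin: "proj X (pjoin X P Q)"
    and rng_pjoin: "rng X (pjoin X P Q) = vspan (rng X P \<union> rng X Q)"
proof -
  have "subsp X (vspan (rng X P \<union> rng X Q))"
    using subsp_rng assms by (intro subsp_vspan) (auto simp: subsp_def)
  then obtain R where "proj X R" "rng X R = vspan (rng X P \<union> rng X Q)"
    using proj_exists[OF assms(1)] by metis
  then have "\<exists>!R. proj X R \<and> rng X R = vspan (rng X P \<union> rng X Q)" using proj_eqI by blast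
  from theI'[OF this] show "proj X (pjoin X P Q)" "rng X (pjoin X P Q) = vspan (rng X P \<union> rng X Q)"
    unfolding pjoin_def by auto
qed

lemma psub_pmeet_iff:
  assumes "finite X" "proj X P" "proj X Q"
  shows "psub X R (pmeet X P Q) \<longleftrightarrow> psub X R P \<and> psub X R Q"
  using assms by (auto simp: psub_def rng_pmeet)

lemma pjoin_psub_iff:
  assumes "finite X" "proj X P" "proj X Q" "proj X R"
  shows "psub X (pjoin X P Q) R \<longleftrightarrow> psub X P R \<and> psub X Q R"
  using assms vspan_superset[of "rng X P \<union> rng X Q"]
    vspan_minimal[OF subsp_rng[OF assms(4)], of "rng X P \<union> rng X Q"]
  by (auto simp: psub_def rng_pjoin)

text \<open>Both sides have the same projectors above them, so they are equal. This De Morgan law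
  moves facts from meets, which are intersections of ranges, to joins.\<close>

lemma compl_pjoin:
  assumes "finite X" "proj X P" "proj X Q"
  shows "pjoin X P Q = idop X - pmeet X (idop X - P) (idop X - Q)"
proof -
  let ?M = "pmeet X (idop X - P) (idop X - Q)"
  have c: "proj X (idop X - P)" "proj X (idop X - Q)" using assms proj_compl by auto
  have M: "proj X ?M" using proj_pmeet assms(1) c by simp
  have J: "proj X (pjoin X P Q)" using proj_pjoin assms by simp
  have key: "psub X (idop X - ?M) R \<longleftrightarrow> psub X P R \<and> psub X Q R" if "proj X R" for R
  proof -
    have "psub X (idop X - ?M) R \<longleftrightarrow> psub X (idop X - R) ?M"
      using psub_compl_iff[of X ?M "idop X - R"] assms(1) M that proj_compl
      by (simp add: compl_compl)
    also have "\<dots> \<longleftrightarrow> psub X P R \<and> psub X Q R"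
      using assms c that by (simp add: psub_pmeet_iff psub_compl_iff)
    finally show ?thesis .
  qed
  have "proj X (idop X - ?M)" using assms(1) M proj_compl by blast
  then show ?thesis
    using key[of "pjoin X P Q"] key[of "idop X - ?M"] J pjoin_psub_iff[OF assms, of "idop X - ?M"]
      pjoin_psub_iff[OF assms J] psub_refl by (intro psub_antisym[of X]) blast+
qed

section \<open>Tensor products and slices\<close>

lemma is_op_tensor: "is_op (Y \<union> Z) (tensor Y Z A C)"
  by (auto simp: is_op_def tensor_def)

lemma tensor_merge:
  assumes "Y \<inter> Z = {}" "a \<in> B Y" "a' \<in> B Y" "b \<in> B Z" "b' \<in> B Z"
  shows "tensor Y Z A C (merge Y a b) (merge Y a' b') = A a a' * C b b'"
  using assms by (simp add: tensor_def merge_in_B restr_merge1 restr_merge2)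

lemma mult_tensor:
  assumes "Y \<inter> Z = {}"
  shows "mult (Y \<union> Z) (tensor Y Z A C) (tensor Y Z A' C') = tensor Y Z (mult Y A A') (mult Z C C')"
proof (rule op_eqI[of "Y \<union> Z"])
  fix f g assume "f \<in> B (Y \<union> Z)" "g \<in> B (Y \<union> Z)"
  then obtain a b a' b' where *: "a \<in> B Y" "b \<in> B Z" "f = merge Y a b"
     "a' \<in> B Y" "b' \<in> B Z" "g = merge Y a' b'" by (metis B_Un_cases)
  have "mult (Y \<union> Z) (tensor Y Z A C) (tensor Y Z A' C') f g =
     (\<Sum>x\<in>B Y. \<Sum>y\<in>B Z. (A a x * A' x a') * (C b y * C' y b'))"
    unfolding mult_def sum_B_Un[OF assms] using * assms by (simp add: tensor_merge mult_ac)
  also have "\<dots> = tensor Y Z (mult Y A A') (mult Z C C') f g"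
    using * assms by (simp add: tensor_merge mult_def sum_product)
  finally show "mult (Y \<union> Z) (tensor Y Z A C) (tensor Y Z A' C') f g =
    tensor Y Z (mult Y A A') (mult Z C C') f g" .
qed (auto intro: is_op_mult is_op_tensor)

lemma adj_tensor: "adj (tensor Y Z A C) = tensor Y Z (adj A) (adj C)"
  by (auto simp: adj_def tensor_def fun_eq_iff)

lemma tensor_idop: "tensor Y Z (idop Y) (idop Z) = idop (Y \<union> Z)"
proof (rule op_eqI[of "Y \<union> Z"])
  fix f g assume *: "f \<in> B (Y \<union> Z)" "g \<in> B (Y \<union> Z)"
  then have "restr Y f = restr Y g \<and> restr Z f = restr Z g \<longleftrightarrow> f = g" by (metis merge_restr)
  with * show "tensor Y Z (idop Y) (idop Z) f g = idop (Y \<union> Z) f g"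
    by (simp add: tensor_def idop_def) blast
qed (auto simp: is_op_tensor)

lemma proj_tensor:
  "Y \<inter> Z = {} \<Longrightarrow> proj Y P \<Longrightarrow> proj Z R \<Longrightarrow> proj (Y \<union> Z) (tensor Y Z P R)"
  by (simp add: proj_def is_op_tensor mult_tensor adj_tensor)

lemma tensor_diff_left: "tensor Y Z (A - A') C = tensor Y Z A C - tensor Y Z A' C"
  by (auto simp: tensor_def fun_eq_iff left_diff_distrib)

text \<open>Makes the tensor lemmas available for implicit extensions, with X - U as the second
  factor.\<close>

lemma ext_eq_tensor:
  assumes "U \<subseteq> X"
  shows "ext U X A = tensor U (X - U) A (idop (X - U))"
proof (intro ext)
  fix f g
  have X: "U \<union> X = X" using assms by blast
  have "restr (X - U) f = restr (X - U) g \<longleftrightarrow> (\<forall>q\<in>X - U. f q = g q)"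
    by (auto simp: restr_def fun_eq_iff)
  then show "Defs.ext U X A f g = tensor U (X - U) A (idop (X - U)) f g"
    by (simp add: ext_def tensor_def X idop_def)
qed

lemma proj_ext:
  assumes "finite X" "U \<subseteq> X" "proj U P"
  shows "proj X (ext U X P)"
proof -
  have "U \<union> X = X" using assms by blast
  then show ?thesis using assms proj_tensor[of U "X - U" P "idop (X - U)"] by (simp add: ext_eq_tensor)
qed

lemma ext_self: "is_op X A \<Longrightarrow> ext X X A = A"
  by (auto simp: ext_def is_op_def restr_eq_self fun_eq_iff)

lemma ext_ext:
  assumes "U \<subseteq> Y" "Y \<subseteq> X"
  shows "ext Y X (ext U Y A) = ext U X A"
  using assms by (auto simp: ext_def fun_eq_iff restr_restr) (auto simp: restr_def)

lemma ext_tensor: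
  assumes "W \<subseteq> Y" "Y \<inter> Z = {}"
  shows "ext (W \<union> Z) (Y \<union> Z) (tensor W Z Q R) = tensor Y Z (ext W Y Q) R"
proof (intro ext)
  fix f g
  have "(\<forall>q\<in>Y \<union> Z - (W \<union> Z). f q = g q) \<longleftrightarrow> (\<forall>q\<in>Y - W. restr Y f q = restr Y g q)"
    using assms(2) by (auto simp: restr_def)
  then show "Defs.ext (W \<union> Z) (Y \<union> Z) (tensor W Z Q R) f g = tensor Y Z (Defs.ext W Y Q) R f g"
    using assms(1) by (simp add: ext_def tensor_def restr_restr)
qed

lemma ext_idop:
  assumes "U \<subseteq> X"
  shows "ext U X (idop U) = idop X"
proof -
  have "U \<union> X = X" using assms by blast
  then show ?thesis using tensor_idop[of U "X - U"] assms by (simp add: ext_eq_tensor)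
qed

lemma ext_diff: "ext U X (A - C) = ext U X A - ext U X C"
  by (auto simp: ext_def fun_eq_iff)

lemma ext_zop: "ext U X zop = zop"
  by (auto simp: ext_def zop_def fun_eq_iff)

lemma mult_ext:
  assumes "finite X" "U \<subseteq> X"
  shows "mult X (ext U X A) (ext U X C) = ext U X (mult U A C)"
proof -
  have X: "U \<union> X = X" using assms by blast
  have "mult (U \<union> (X - U)) (tensor U (X - U) A (idop (X - U))) (tensor U (X - U) C (idop (X - U)))
    = tensor U (X - U) (mult U A C) (mult (X - U) (idop (X - U)) (idop (X - U)))"
    by (rule mult_tensor) blast
  then show ?thesis using assms by (simp add: X ext_eq_tensor idop_mult)
qed

text \<open>The partial inner product of v with the basis vector b of the complementary register. A
  vector on the joint register is determined by its slices, and \<open>A \<otimes> I\<close> acts on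
  each of them separately.\<close>

definition vslice :: "nat set \<Rightarrow> asg \<Rightarrow> (asg \<Rightarrow> complex) \<Rightarrow> asg \<Rightarrow> complex" where
  "vslice Y b v = (\<lambda>a. if a \<in> B Y then v (merge Y a b) else 0)"

lemma is_vec_vslice [simp]: "is_vec Y (vslice Y b v)"
  by (simp add: is_vec_def vslice_def)

lemma vslice_eqI:
  assumes "is_vec (Y \<union> Z) u" "is_vec (Y \<union> Z) v"
    and "\<And>b. b \<in> B Z \<Longrightarrow> vslice Y b u = vslice Y b v"
  shows "u = v"
proof (rule vec_eqI[OF assms(1,2)])
  fix f assume "f \<in> B (Y \<union> Z)"
  then obtain a b where *: "a \<in> B Y" "b \<in> B Z" "f = merge Y a b" by (rule B_Un_cases)
  then show "u f = v f" using fun_cong[OF assms(3)[OF *(2)], of a] by (simp add: vslice_def)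
qed

lemma vslice_app_tensor_idop:
  assumes "Y \<inter> Z = {}" "finite Z" "b \<in> B Z" "is_op Y A"
  shows "vslice Y b (app (Y \<union> Z) (tensor Y Z A (idop Z)) v) = app Y A (vslice Y b v)"
proof (rule vec_eqI[of Y])
  fix a assume a: "a \<in> B Y"
  have "app (Y \<union> Z) (tensor Y Z A (idop Z)) v (merge Y a b) =
     (\<Sum>x\<in>B Y. \<Sum>y\<in>B Z. A a x * idop Z b y * v (merge Y x y))"
    unfolding app_def sum_B_Un[OF assms(1)] using assms a by (simp add: tensor_merge)
  also have "\<dots> = (\<Sum>x\<in>B Y. \<Sum>y\<in>B Z. if y = b then A a x * v (merge Y x y) else 0)"
    using assms(3) by (intro sum.cong refl) (auto simp: idop_def)
  also have "\<dots> = app Y A (vslice Y b v) a"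
    using assms by (simp add: finite_B app_def vslice_def)
  finally show "vslice Y b (app (Y \<union> Z) (tensor Y Z A (idop Z)) v) a = app Y A (vslice Y b v) a"
    using a by (simp add: vslice_def)
qed (auto simp: assms is_vec_app)

lemma app_tensor_idop_eq_self_iff:
  assumes "Y \<inter> Z = {}" "finite Z" "is_op Y A" "is_vec (Y \<union> Z) v"
  shows "app (Y \<union> Z) (tensor Y Z A (idop Z)) v = v \<longleftrightarrow>
    (\<forall>b\<in>B Z. app Y A (vslice Y b v) = vslice Y b v)"
  using vslice_eqI[of Y Z "app (Y \<union> Z) (tensor Y Z A (idop Z)) v" v]
    vslice_app_tensor_idop[OF assms(1,2) _ assms(3), of _ v] assms(4) is_vec_app[OF is_op_tensor]
  by metis

lemma app_tensor_idop_eq_0_iff: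
  assumes "Y \<inter> Z = {}" "finite Z" "is_op Y A"
  shows "app (Y \<union> Z) (tensor Y Z A (idop Z)) v = (\<lambda>_. 0) \<longleftrightarrow>
    (\<forall>b\<in>B Z. app Y A (vslice Y b v) = (\<lambda>_. 0))"
proof -
  have "vslice Y b (\<lambda>_. 0) = (\<lambda>_. 0)" for b by (simp add: vslice_def fun_eq_iff)
  moreover have "is_vec (Y \<union> Z) (\<lambda>_. 0)" by (simp add: is_vec_def)
  ultimately show ?thesis
    using vslice_eqI[of Y Z "app (Y \<union> Z) (tensor Y Z A (idop Z)) v" "\<lambda>_. 0"]
      vslice_app_tensor_idop[OF assms(1,2) _ assms(3), of _ v] is_vec_app[OF is_op_tensor]
    by metis
qed

text \<open>Membership is decided slice by slice, so extension preserves inclusions and meets. A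
  join is not described slicewise; \<open>ext_pjoin\<close> goes through complements
  instead.\<close>

lemma rng_ext_iff:
  assumes "finite X" "U \<subseteq> X" "proj U P"
  shows "v \<in> rng X (ext U X P) \<longleftrightarrow> is_vec X v \<and> (\<forall>b\<in>B (X - U). vslice U b v \<in> rng U P)"
proof -
  have X: "U \<union> X = X" using assms by blast
  have "app X (ext U X P) v = v \<longleftrightarrow> (\<forall>b\<in>B (X - U). app U P (vslice U b v) = vslice U b v)"
    if "is_vec X v"
    using app_tensor_idop_eq_self_iff[of U "X - U" P v] assms that
    by (simp add: X ext_eq_tensor proj_is_op)
  then show ?thesis using assms by (auto simp: rng_proj proj_ext)
qed

lemma ext_pmeet:
  assumes "finite X" "U \<subseteq> X" "proj U P" "proj U Q"
  shows "ext U X (pmeet U P Q) = pmeet X (ext U X P) (ext U X Q)"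
proof -
  have U: "finite U" using assms finite_subset by blast
  show ?thesis
    using assms proj_pmeet[OF U] proj_pmeet[OF assms(1)] proj_ext
    by (intro proj_eqI[of X]) (auto simp: rng_pmeet rng_ext_iff U)
qed

lemma ext_mono:
  assumes "finite X" "U \<subseteq> X" "proj U P" "proj U Q" "psub U P Q"
  shows "psub X (ext U X P) (ext U X Q)"
  using assms unfolding psub_def by (auto simp: rng_ext_iff subset_iff)

lemma ext_pjoin:
  assumes "finite X" "U \<subseteq> X" "proj U P" "proj U Q"
  shows "ext U X (pjoin U P Q) = pjoin X (ext U X P) (ext U X Q)"
proof -
  have "finite U" using assms finite_subset by blast
  then show ?thesis
    using assms by (simp add: compl_pjoin proj_ext ext_diff ext_idop ext_pmeet proj_compl)
qed

section \<open>Super-operators and their duals\<close>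

text \<open>The V-block at position (b, d) when A is read as a block matrix over the remaining
  qubits. \<open>sext\<close> applies the super-operator to every block. Only the values of b and d
  outside V matter, so full basis states may serve as indices too.\<close>

definition slice :: "nat set \<Rightarrow> asg \<Rightarrow> asg \<Rightarrow> op \<Rightarrow> op" where
  "slice V b d A = (\<lambda>a c. if a \<in> B V \<and> c \<in> B V then A (merge V a b) (merge V c d) else 0)"

lemma is_op_slice [simp]: "is_op V (slice V b d A)"
  by (auto simp: is_op_def slice_def)

lemma sext_eq:
  "sext V X E \<rho> f g =
    (if f \<in> B X \<and> g \<in> B X then E (slice V f g \<rho>) (restr V f) (restr V g) else 0)"
  by (simp add: sext_def slice_def)

lemma is_op_sext: "is_op X (sext V X E \<rho>)"
  by (auto simp: is_op_def sext_eq)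

lemma slice_merge: "slice V (merge V a b) (merge V c d) A = slice V b d A"
  by (simp add: slice_def merge_merge cong: if_cong)

lemma slice_diff: "slice V b d (A - C) = slice V b d A - slice V b d C"
  by (auto simp: slice_def fun_eq_iff)

lemma slice_sext:
  assumes "V \<subseteq> X" "b \<in> B (X - V)" "d \<in> B (X - V)" "\<And>A. is_op V (E A)"
  shows "slice V b d (sext V X E \<rho>) = E (slice V b d \<rho>)"
proof (rule op_eqI[of V])
  fix a c assume *: "a \<in> B V" "c \<in> B V"
  have X: "V \<union> (X - V) = X" using assms by blast
  have "merge V a b \<in> B X" "merge V c d \<in> B X"
    using merge_in_B[of a V b "X - V"] merge_in_B[of c V d "X - V"] * assms unfolding X by auto
  then show "slice V b d (sext V X E \<rho>) a c = E (slice V b d \<rho>) a c"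
    using * by (simp add: slice_def[of V b d "sext V X E \<rho>"] sext_eq slice_merge restr_merge1)
qed (use assms in auto)

lemma sum_B_split:
  assumes "V \<subseteq> X"
  shows "(\<Sum>f\<in>B X. F f) = (\<Sum>a\<in>B V. \<Sum>b\<in>B (X - V). F (merge V a b))"
proof -
  have "V \<union> (X - V) = X" using assms by blast
  then show ?thesis using sum_B_Un[of V "X - V" F] by simp
qed

lemma tr_slice:
  assumes "V \<subseteq> X"
  shows "tr X A = (\<Sum>b\<in>B (X - V). tr V (slice V b b A))"
  unfolding tr_def sum_B_split[OF assms] by (subst sum.swap) (simp add: slice_def)

lemma tr_mult_slice:
  assumes "V \<subseteq> X"
  shows "tr X (mult X A C) =
    (\<Sum>b\<in>B (X - V). \<Sum>d\<in>B (X - V). tr V (mult V (slice V b d A) (slice V d b C)))"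
proof -
  have "tr X (mult X A C) = (\<Sum>a\<in>B V. \<Sum>b\<in>B (X - V). \<Sum>c\<in>B V. \<Sum>d\<in>B (X - V).
      A (merge V a b) (merge V c d) * C (merge V c d) (merge V a b))"
    unfolding tr_def mult_def sum_B_split[OF assms] by simp
  also have "\<dots> = (\<Sum>b\<in>B (X - V). \<Sum>a\<in>B V. \<Sum>c\<in>B V. \<Sum>d\<in>B (X - V).
      A (merge V a b) (merge V c d) * C (merge V c d) (merge V a b))"
    by (rule sum.swap)
  also have "\<dots> = (\<Sum>b\<in>B (X - V). \<Sum>a\<in>B V. \<Sum>d\<in>B (X - V). \<Sum>c\<in>B V.
      A (merge V a b) (merge V c d) * C (merge V c d) (merge V a b))"
    by (rule sum.cong[OF refl], rule sum.cong[OF refl], rule sum.swap)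
  also have "\<dots> = (\<Sum>b\<in>B (X - V). \<Sum>d\<in>B (X - V). \<Sum>a\<in>B V. \<Sum>c\<in>B V.
      A (merge V a b) (merge V c d) * C (merge V c d) (merge V a b))"
    by (rule sum.cong[OF refl], rule sum.swap)
  finally show ?thesis by (simp add: tr_def mult_def slice_def)
qed

text \<open>The form of a diagonal block at v is the form of the whole matrix at the product of v
  with the basis vector b.\<close>

lemma psd_slice:
  assumes "finite X" "V \<subseteq> X" "b \<in> B (X - V)" "psd X \<rho>"
  shows "psd V (slice V b b \<rho>)"
proof -
  have "ip V v (app V (slice V b b \<rho>) v) =
    ip X (\<lambda>f. if restr (X - V) f = b then v (restr V f) else 0)
      (app X \<rho> (\<lambda>f. if restr (X - V) f = b then v (restr V f) else 0))"
    (is "_ = ip X ?w (app X \<rho> ?w)") for v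
  proof -
    have w: "?w (merge V a d) = (if d = b then v a else 0)" if "a \<in> B V" "d \<in> B (X - V)" for a d
      using that by (simp add: restr_merge1 restr_merge2)
    have fin: "finite (B (X - V))" using assms(1) finite_B by blast
    have "app X \<rho> ?w f = (\<Sum>c\<in>B V. \<rho> f (merge V c b) * v c)" for f
    proof -
      have "app X \<rho> ?w f = (\<Sum>c\<in>B V. \<Sum>d\<in>B (X - V). if d = b then \<rho> f (merge V c d) * v c else 0)"
        unfolding app_def sum_B_split[OF assms(2)] by (intro sum.cong refl) (simp add: w)
      then show ?thesis using assms(3) fin by simp
    qed
    then have "ip X ?w (app X \<rho> ?w) = (\<Sum>a\<in>B V. \<Sum>d\<in>B (X - V). if d = b then
        cnj (v a) * (\<Sum>c\<in>B V. \<rho> (merge V a d) (merge V c b) * v c) else 0)"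
      unfolding ip_def sum_B_split[OF assms(2)] by (intro sum.cong refl) (simp add: w)
    then show ?thesis using assms(3) fin by (simp add: ip_def app_def slice_def)
  qed
  then show ?thesis using assms(4) by (simp add: psd_iff)
qed

text \<open>The entry (f, g) is forced by the duality
  \<open>tr (A E(\<rho>)) = tr (E\<^sup>*(A) \<rho>)\<close> at the matrix unit
  \<open>|g><f|\<close>, which explains the exchanged indices.\<close>

definition dual :: "nat set \<Rightarrow> sop \<Rightarrow> sop" where
  "dual V E A = (\<lambda>f g. if f \<in> B V \<and> g \<in> B V
     then tr V (mult V A (E (\<lambda>x y. of_bool (x = g \<and> y = f)))) else 0)"

lemma is_op_dual [simp]: "is_op V (dual V E A)"
  by (auto simp: is_op_def dual_def)

lemma dual_diff: "dual V E (A - C) = dual V E A - dual V E C"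
  by (auto simp: dual_def fun_eq_iff mult_diff_left tr_diff)

lemma dual_scale: "dual V E (\<lambda>f g. c * A f g) = (\<lambda>f g. c * dual V E A f g)"
  by (auto simp: dual_def fun_eq_iff mult_def tr_def sum_distrib_left mult.assoc)

lemma dual_zop: "dual V E zop = zop"
  by (auto simp: dual_def fun_eq_iff mult_def tr_def zop_def)

lemma sext_dual_diff: "sext V X (dual V E) (A - C) = sext V X (dual V E) A - sext V X (dual V E) C"
  by (simp add: fun_eq_iff sext_eq slice_diff dual_diff)

lemma sext_dual_zop: "sext V X (dual V E) zop = zop"
proof -
  have "slice V f g zop = zop" for f g by (simp add: slice_def zop_def fun_eq_iff)
  then have "sext V X (dual V E) zop f g = zop f g" for f g
    by (simp only: sext_eq dual_zop) (simp add: zop_def)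
  then show ?thesis by blast
qed

text \<open>Homogeneity of F is enough: V does not meet Z, so each V-block of
  \<open>A \<otimes> C\<close> is a block of A times a single entry of C. The lemma therefore serves
  programs and their duals alike.\<close>

lemma sext_tensor:
  assumes "V \<subseteq> Y" "Y \<inter> Z = {}"
    and hom: "\<And>A c. is_op V A \<Longrightarrow> F (\<lambda>f g. c * A f g) = (\<lambda>f g. c * F A f g)"
  shows "sext V (Y \<union> Z) F (tensor Y Z A C) = tensor Y Z (sext V Y F A) C"
proof (rule op_eqI[of "Y \<union> Z"])
  fix f g assume *: "f \<in> B (Y \<union> Z)" "g \<in> B (Y \<union> Z)"
  have m: "merge V a h \<in> B (Y \<union> Z)" "restr Y (merge V a h) = merge V a (restr Y h)"
    "restr Z (merge V a h) = restr Z h" if "a \<in> B V" "h \<in> B (Y \<union> Z)" for a h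
    using that assms(1,2) by (auto simp: B_def merge_def restr_def fun_eq_iff)
  have "slice V f g (tensor Y Z A C) =
      (\<lambda>a c. C (restr Z f) (restr Z g) * slice V (restr Y f) (restr Y g) A a c)"
    using * by (simp add: slice_def tensor_def m fun_eq_iff mult.commute)
  then have "F (slice V f g (tensor Y Z A C)) =
      (\<lambda>a c. C (restr Z f) (restr Z g) * F (slice V (restr Y f) (restr Y g) A) a c)"
    by (simp add: hom)
  then show "sext V (Y \<union> Z) F (tensor Y Z A C) f g = tensor Y Z (sext V Y F A) C f g"
    using * assms(1) by (simp add: sext_eq tensor_def restr_restr mult.commute)
qed (auto simp: is_op_sext is_op_tensor)

text \<open>Duals commute with enlarging the register, so correctness on any register X can be read
  off from operators on the least one.\<close>

lemma sext_dual_ext: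
  assumes "V \<subseteq> Y" "Y \<subseteq> X"
  shows "sext V X (dual V E) (ext Y X A) = ext Y X (sext V Y (dual V E) A)"
proof -
  have "Y \<union> X = X" using assms by blast
  then show ?thesis
    using sext_tensor[of V Y "X - Y" "dual V E" A "idop (X - Y)"] assms
    by (simp add: ext_eq_tensor dual_scale)
qed

lemma DProg_is_op: "DProg V E \<Longrightarrow> is_op V (E A)"
  by (simp add: DProg_def)

lemma DProg_scale: "DProg V E \<Longrightarrow> is_op V A \<Longrightarrow> E (\<lambda>f g. c * A f g) = (\<lambda>f g. c * E A f g)"
  by (simp add: DProg_def)

lemma DProg_add:
  "DProg V E \<Longrightarrow> is_op V A \<Longrightarrow> is_op V C \<Longrightarrow>
    E (\<lambda>f g. A f g + C f g) = (\<lambda>f g. E A f g + E C f g)"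
  by (simp add: DProg_def)

lemma DProg_sum:
  assumes "DProg V E" "finite I" "\<And>i. i \<in> I \<Longrightarrow> is_op V (A i)"
  shows "E (\<lambda>f g. \<Sum>i\<in>I. c i * A i f g) = (\<lambda>f g. \<Sum>i\<in>I. c i * E (A i) f g)"
  using assms(2,3)
proof (induction I rule: finite_induct)
  case empty
  then show ?case using DProg_scale[OF assms(1) is_op_zop, of 0] by simp
next
  case (insert i I)
  have "is_op V (\<lambda>f g. c i * A i f g)" "is_op V (\<lambda>f g. \<Sum>i\<in>I. c i * A i f g)"
    using insert by (auto simp: is_op_def)
  then have "E (\<lambda>f g. c i * A i f g + (\<Sum>i\<in>I. c i * A i f g)) =
      (\<lambda>f g. E (\<lambda>f g. c i * A i f g) f g + E (\<lambda>f g. \<Sum>i\<in>I. c i * A i f g) f g)"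
    by (rule DProg_add[OF assms(1)])
  then show ?case using insert DProg_scale[OF assms(1), of "A i" "c i"] by simp
qed

text \<open>Both sides are linear in \<rho>, and on matrix units they agree by the definition of
  \<open>dual\<close>.\<close>

lemma tr_dual:
  assumes "finite V" "DProg V E" "is_op V \<rho>"
  shows "tr V (mult V A (E \<rho>)) = tr V (mult V (dual V E A) \<rho>)"
proof -
  \<comment> \<open>The matrix unit with its single 1 at position p.\<close>
  define u :: "asg \<times> asg \<Rightarrow> op" where "u p = (\<lambda>x y. of_bool (x = fst p \<and> y = snd p))" for p
  have fin: "finite (B V \<times> B V)" using assms(1) finite_B by blast
  have "\<rho> = (\<lambda>x y. \<Sum>p\<in>B V \<times> B V. \<rho> (fst p) (snd p) * u p x y)"
  proof (intro ext)
    fix x y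
    have "(\<Sum>p\<in>B V \<times> B V. \<rho> (fst p) (snd p) * u p x y) =
        (\<Sum>p\<in>B V \<times> B V. if p = (x, y) then \<rho> x y else 0)"
      by (intro sum.cong refl) (auto simp: u_def)
    also have "\<dots> = \<rho> x y" using fin assms(3) by (auto simp: is_op_def)
    finally show "\<rho> x y = (\<Sum>p\<in>B V \<times> B V. \<rho> (fst p) (snd p) * u p x y)" by simp
  qed
  then have "E \<rho> = E (\<lambda>x y. \<Sum>p\<in>B V \<times> B V. \<rho> (fst p) (snd p) * u p x y)" by (rule arg_cong)
  also have "\<dots> = (\<lambda>x y. \<Sum>p\<in>B V \<times> B V. \<rho> (fst p) (snd p) * E (u p) x y)"
    by (rule DProg_sum[OF assms(2) fin]) (auto simp: u_def is_op_def)
  finally have E: "E \<rho> = (\<lambda>x y. \<Sum>p\<in>B V \<times> B V. \<rho> (fst p) (snd p) * E (u p) x y)" .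
  have "tr V (mult V A (E \<rho>)) =
      (\<Sum>f\<in>B V. \<Sum>h\<in>B V. \<Sum>p\<in>B V \<times> B V. \<rho> (fst p) (snd p) * (A f h * E (u p) h f))"
    by (simp add: E tr_def mult_def sum_distrib_left mult_ac)
  also have "\<dots> = (\<Sum>f\<in>B V. \<Sum>p\<in>B V \<times> B V. \<Sum>h\<in>B V. \<rho> (fst p) (snd p) * (A f h * E (u p) h f))"
    by (rule sum.cong[OF refl], rule sum.swap)
  also have "\<dots> = (\<Sum>p\<in>B V \<times> B V. \<Sum>f\<in>B V. \<Sum>h\<in>B V. \<rho> (fst p) (snd p) * (A f h * E (u p) h f))"
    by (rule sum.swap)
  also have "\<dots> = (\<Sum>p\<in>B V \<times> B V. dual V E A (snd p) (fst p) * \<rho> (fst p) (snd p))"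
    by (intro sum.cong refl) (auto simp: dual_def tr_def mult_def u_def sum_distrib_left mult_ac)
  also have "\<dots> = (\<Sum>g\<in>B V. \<Sum>f\<in>B V. dual V E A f g * \<rho> g f)"
    by (simp add: sum.cartesian_product case_prod_unfold)
  also have "\<dots> = tr V (mult V (dual V E A) \<rho>)"
    unfolding tr_def mult_def by (rule sum.swap)
  finally show ?thesis .
qed

lemma tr_sext_dual:
  assumes "finite X" "V \<subseteq> X" "DProg V E"
  shows "tr X (mult X A (sext V X E \<rho>)) = tr X (mult X (sext V X (dual V E) A) \<rho>)"
proof -
  have V: "finite V" using assms finite_subset by blast
  show ?thesis
    unfolding tr_mult_slice[OF assms(2)]
    using assms V by (intro sum.cong refl) (simp add: slice_sext DProg_is_op tr_dual)
qed

text \<open>\<open>DProg\<close> bounds the trace on V only. On a larger register the trace is the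
  sum over the diagonal V-blocks, which are positive.\<close>

lemma tr_sext_le:
  assumes "finite X" "V \<subseteq> X" "DProg V E" "psd X \<rho>"
  shows "Re (tr X (sext V X E \<rho>)) \<le> Re (tr X \<rho>)"
proof -
  have "Re (tr V (E (slice V b b \<rho>))) \<le> Re (tr V (slice V b b \<rho>))" if "b \<in> B (X - V)" for b
    using psd_slice[OF assms(1,2) that assms(4)] assms(3) by (simp add: DProg_def)
  then show ?thesis
    unfolding tr_slice[OF assms(2)]
    using assms by (simp add: slice_sext DProg_is_op sum_mono)
qed

lemma psd_sext: "finite X \<Longrightarrow> V \<subseteq> X \<Longrightarrow> DProg V E \<Longrightarrow> psd X \<rho> \<Longrightarrow> psd X (sext V X E \<rho>)"
  by (simp add: DProg_def)

section \<open>Effects\<close>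

text \<open>Positivity of M as a functional on positive matrices. In this form it passes directly
  through the duality \<open>tr_sext_dual\<close>; \<open>pos_fun_psd\<close> then gives matrix
  positivity. The converse is shown for projectors, where idempotence and cyclicity of the trace
  suffice.\<close>

definition pos_fun :: "nat set \<Rightarrow> op \<Rightarrow> bool" where
  "pos_fun X M \<longleftrightarrow> is_op X M \<and>
    (\<forall>\<rho>. psd X \<rho> \<longrightarrow> Im (tr X (mult X M \<rho>)) = 0 \<and> 0 \<le> Re (tr X (mult X M \<rho>)))"

definition effect :: "nat set \<Rightarrow> op \<Rightarrow> bool" where
  "effect X M \<longleftrightarrow> pos_fun X M \<and> pos_fun X (idop X - M)"

lemma effect_compl: "effect X M \<Longrightarrow> effect X (idop X - M)"
  by (simp add: effect_def compl_compl)

lemma effect_is_op: "effect X M \<Longrightarrow> is_op X M"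
  by (simp add: effect_def pos_fun_def)

lemma pos_fun_psd:
  assumes "finite X" "pos_fun X M"
  shows "psd X M"
proof -
  have "Im (ip X v (app X M v)) = 0 \<and> 0 \<le> Re (ip X v (app X M v))" for v
  proof -
    \<comment> \<open>\<open>psd\<close> quantifies over all functions, while \<open>|w><w|\<close>
      is an operator on X only for w supported on the basis of X.\<close>
    define w where "w = (\<lambda>f. if f \<in> B X then v f else 0)"
    have "is_vec X w" by (simp add: w_def is_vec_def)
    moreover have "ip X v (app X M v) = ip X w (app X M w)"
      by (simp add: ip_def app_def w_def)
    ultimately show ?thesis
      using assms(2) psd_outer[of X w] tr_mult_outer[of X M w] unfolding pos_fun_def by metis
  qed
  then show ?thesis using assms(2) by (simp add: psd_iff pos_fun_def)
qed

lemma pos_fun_proj: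
  assumes "finite X" "proj X P"
  shows "pos_fun X P"
proof -
  have "Im (tr X (mult X P A)) = 0 \<and> 0 \<le> Re (tr X (mult X P A))" if "psd X A" for A
  proof -
    have "tr X (mult X P A) = tr X (mult X P (mult X P A))"
      using assms(2) by (simp add: proj_def flip: mult_assoc)
    also have "\<dots> = tr X (mult X (mult X P A) P)" by (rule tr_mult_commute)
    also have "\<dots> = tr X (mult X P (mult X A (adj P)))"
      using assms(2) by (simp add: proj_def mult_assoc)
    finally show ?thesis
      using psd_tr[OF assms(1) psd_conj[OF that proj_is_op[OF assms(2)]]] by simp
  qed
  then show ?thesis using proj_is_op[OF assms(2)] by (simp add: pos_fun_def)
qed

text \<open>Positivity of the complement is the chain
  \<open>tr (Q E(\<rho>)) \<le> tr (E(\<rho>)) \<le> tr \<rho>\<close>: first positivity of I - Q,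
  then the trace bound on E.\<close>

lemma effect_sext_dual:
  assumes "finite X" "V \<subseteq> X" "DProg V E" "proj X Q"
  shows "effect X (sext V X (dual V E) Q)"
proof -
  have "Im (tr X (mult X (idop X - sext V X (dual V E) Q) \<rho>)) = 0 \<and>
      0 \<le> Re (tr X (mult X (idop X - sext V X (dual V E) Q) \<rho>))" if "psd X \<rho>" for \<rho>
  proof -
    have s: "psd X (sext V X E \<rho>)" using psd_sext assms that by blast
    have "pos_fun X (idop X - Q)" using assms pos_fun_proj proj_compl by blast
    then have 1: "0 \<le> Re (tr X (mult X (idop X - Q) (sext V X E \<rho>)))"
      using s by (simp add: pos_fun_def)
    have 2: "Im (tr X (mult X Q (sext V X E \<rho>))) = 0"
      using pos_fun_proj[OF assms(1,4)] s by (simp add: pos_fun_def)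
    have 3: "tr X (mult X (idop X - sext V X (dual V E) Q) \<rho>) = tr X \<rho> - tr X (mult X Q (sext V X E \<rho>))"
      using assms psd_is_op[OF that] by (simp add: mult_diff_left tr_diff idop_mult tr_sext_dual)
    have "Re (tr X (mult X Q (sext V X E \<rho>))) \<le> Re (tr X (sext V X E \<rho>))"
      using 1 assms(1) psd_is_op[OF s] by (simp add: mult_diff_left tr_diff idop_mult)
    also have "\<dots> \<le> Re (tr X \<rho>)" using tr_sext_le assms that by blast
    finally show ?thesis using 2 3 psd_tr(1)[OF assms(1) that] by simp
  qed
  moreover have "pos_fun X (sext V X (dual V E) Q)"
    using pos_fun_proj[OF assms(1,4)] psd_sext[OF assms(1-3)]
    by (simp add: pos_fun_def is_op_sext flip: tr_sext_dual[OF assms(1-3), of Q])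
  ultimately show ?thesis by (simp add: effect_def pos_fun_def is_op_diff is_op_sext)
qed

text \<open>If M fixes the range of P, then M - P is the compression of M to the complement of P,
  so its positivity is inherited from M without any spectral decomposition.\<close>

lemma proj_le_effect:
  assumes "finite X" "proj X P" "effect X M" "mult X M P = P" "psd X \<rho>"
  shows "Re (tr X (mult X P \<rho>)) \<le> Re (tr X (mult X M \<rho>))"
proof -
  define C where "C = idop X - P"
  have M: "is_op X M" "adj M = M"
    using assms effect_def effect_is_op psd_adj pos_fun_psd by blast+
  have C: "proj X C" "adj C = C" using proj_compl[OF assms(1,2)] by (simp_all add: C_def proj_def)
  have PM: "mult X P M = P"
    using arg_cong[OF assms(4), of adj] assms(2) M by (simp add: adj_mult proj_def)
  have P: "is_op X P" "mult X P P = P" using assms(2) by (auto simp: proj_def)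
  have "mult X C M = M - P"
    using assms(1) M by (simp add: C_def mult_diff_left idop_mult PM)
  moreover have "mult X (M - P) C = M - P"
    using assms(1,4) M P unfolding C_def
    by (simp only: mult_diff_left mult_diff_right mult_idop) (simp add: fun_eq_iff)
  ultimately have "mult X (mult X C M) C = M - P" by simp
  then have "tr X (mult X (M - P) \<rho>) = tr X (mult X C (mult X M (mult X C \<rho>)))"
    by (simp flip: mult_assoc)
  also have "\<dots> = tr X (mult X (mult X M (mult X C \<rho>)) C)" by (rule tr_mult_commute)
  also have "\<dots> = tr X (mult X M (mult X C (mult X \<rho> (adj C))))" by (simp add: mult_assoc C(2))
  finally have "0 \<le> Re (tr X (mult X (M - P) \<rho>))"
    using psd_conj[OF assms(5) proj_is_op[OF C(1)]] assms(3) by (simp add: effect_def pos_fun_def)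
  then show ?thesis by (simp add: mult_diff_left tr_diff)
qed

text \<open>Testing with \<open>|u><u|\<close> for a unit vector u of P gives
  \<open><u, (I - M) u> \<le> 0\<close>. As I - M is positive, the form vanishes there, and
  \<open>psd_kernel\<close> yields M u = u.\<close>

lemma effect_fixes_of_proj_le:
  assumes "finite X" "proj X P" "effect X M"
    and le: "\<And>\<rho>. density X \<rho> \<Longrightarrow> Re (tr X (mult X P \<rho>)) \<le> Re (tr X (mult X M \<rho>))"
    and v: "v \<in> rng X P"
  shows "app X M v = v"
proof (cases "v = (\<lambda>_. 0)")
  case False
  have vv: "is_vec X v" "app X P v = v" using v assms(2) by (auto simp: rng_proj)
  define n where "n = Re (ip X v v)"
  have n: "ip X v v = complex_of_real n" by (simp add: n_def ip_self)
  have "n \<noteq> 0" using False ip_self_eq_0[OF assms(1) vv(1)] n by auto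
  then have "0 < n" using ip_self_nonneg[of X v] by (simp add: n_def)
  define c where "c = complex_of_real (1 / sqrt n)"
  have cc: "cnj c = c" "c * c * ip X v v = 1" "c \<noteq> 0"
    using \<open>0 < n\<close> by (simp_all add: c_def n flip: of_real_mult)
  define u where "u = (\<lambda>f. c * v f)"
  have u: "is_vec X u" "app X P u = u" using vv by (auto simp: u_def app_scale is_vec_def)
  have "ip X u u = c * c * ip X v v" by (simp add: u_def ip_def cc sum_distrib_left mult_ac)
  then have "ip X u u = 1" using cc by simp
  then have "density X (outer u u)" using psd_outer[OF u(1)] by (simp add: density_def tr_outer)
  then have "Re (ip X u u) \<le> Re (ip X u (app X M u))"
    using le[of "outer u u"] by (simp add: tr_mult_outer u)
  then have "Re (ip X u (app X (idop X - M) u)) \<le> 0"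
    using u assms(1) by (simp add: app_diff_op app_idop ip_diff_right)
  moreover have psd: "psd X (idop X - M)" using assms effect_def pos_fun_psd by blast
  ultimately have "Re (ip X u (app X (idop X - M) u)) = 0" using psd_ip[OF psd, of u] by simp
  then have "app X (idop X - M) u = (\<lambda>_. 0)" by (rule psd_kernel[OF assms(1) psd])
  then have "app X M u = u" using u assms(1) by (simp add: app_diff_op app_idop fun_eq_iff)
  then show ?thesis using cc by (simp add: u_def app_scale fun_eq_iff)
qed simp

lemma mult_proj_eqI:
  assumes "proj X P" "\<And>v. v \<in> rng X P \<Longrightarrow> app X M v = v"
  shows "mult X M P = P"
proof (intro ext)
  fix f g
  show "mult X M P f g = P f g"
    using fun_cong[OF assms(2)[OF proj_column[OF assms(1), of g]], of f] by (simp add: app_def mult_def)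
qed

section \<open>Correctness formulas as conditions on vectors\<close>

lemma sat_effect_iff:
  assumes "finite Y" "S \<noteq> {}" "proj Y P"
    and eff: "\<And>X E. finite X \<Longrightarrow> Y \<subseteq> X \<Longrightarrow> E \<in> S \<Longrightarrow> effect X (ext Y X (M E))"
    and M: "\<And>E. is_op Y (M E)"
  shows "(\<forall>X \<rho>. finite X \<and> Y \<subseteq> X \<and> density X \<rho> \<longrightarrow>
      Re (tr X (mult X (ext Y X P) \<rho>)) \<le> (INF E\<in>S. Re (tr X (mult X (ext Y X (M E)) \<rho>)))) \<longleftrightarrow>
    (\<forall>E\<in>S. \<forall>v\<in>rng Y P. app Y (M E) v = v)" (is "?L \<longleftrightarrow> ?R")
proof -
  \<comment> \<open>An infimum of reals lies below its members only for sets bounded below; here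
    positivity of the effects gives the bound 0.\<close>
  have bdd: "bdd_below ((\<lambda>E. Re (tr X (mult X (ext Y X (M E)) \<rho>))) ` S)"
    if "finite X" "Y \<subseteq> X" "density X \<rho>" for X \<rho>
    using eff[OF that(1,2)] that(3) unfolding effect_def pos_fun_def density_def
    by (intro bdd_belowI2[of _ 0]) blast
  show ?thesis
  proof
    assume L: ?L
    show ?R
    proof (intro ballI)
      fix E v assume E: "E \<in> S" and v: "v \<in> rng Y P"
      have "effect Y (M E)" using eff[OF assms(1) _ E] by (simp add: ext_self M)
      then show "app Y (M E) v = v"
      proof (rule effect_fixes_of_proj_le[OF assms(1,3) _ _ v])
        fix \<rho> assume d: "density Y \<rho>"
        then have "Re (tr Y (mult Y P \<rho>)) \<le> (INF E\<in>S. Re (tr Y (mult Y (M E) \<rho>)))"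
          using L assms(1) by (force simp: ext_self M proj_is_op[OF assms(3)])
        also have "\<dots> \<le> Re (tr Y (mult Y (M E) \<rho>))"
          using bdd[OF assms(1) _ d] E by (intro cINF_lower) (simp_all add: ext_self M)
        finally show "Re (tr Y (mult Y P \<rho>)) \<le> Re (tr Y (mult Y (M E) \<rho>))" .
      qed
    qed
  next
    assume R: ?R
    show ?L
    proof (intro allI impI)
      fix X \<rho> assume *: "finite X \<and> Y \<subseteq> X \<and> density X \<rho>"
      have "Re (tr X (mult X (ext Y X P) \<rho>)) \<le> Re (tr X (mult X (ext Y X (M E)) \<rho>))" if "E \<in> S" for E
      \<comment> \<open>The fixed-point condition is known on Y only. As the operator identity
        \<open>M P = P\<close> it extends to X, where it gives the inequality back.\<close>
      proof (rule proj_le_effect)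
        have "mult Y (M E) P = P" using R that by (intro mult_proj_eqI[OF assms(3)]) auto
        then show "mult X (ext Y X (M E)) (ext Y X P) = ext Y X P" using * by (simp add: mult_ext)
      qed (use * that eff assms(3) in \<open>auto simp: density_def proj_ext\<close>)
      then show "Re (tr X (mult X (ext Y X P) \<rho>)) \<le> (INF E\<in>S. Re (tr X (mult X (ext Y X (M E)) \<rho>)))"
        using assms(2) by (intro cINF_greatest) auto
    qed
  qed
qed

lemma sat_tot_iff:
  assumes "finite V" "NProg V S" "finite U1" "finite U2" "proj U1 P" "proj U2 Q"
    and Y: "Y = V \<union> U1 \<union> U2"
  shows "sat_tot S V U1 P U2 Q \<longleftrightarrow> (\<forall>E\<in>S. \<forall>v\<in>rng Y (ext U1 Y P).
    app Y (sext V Y (dual V E) (ext U2 Y Q)) v = v)"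
proof -
  have S: "S \<noteq> {}" "\<And>E. E \<in> S \<Longrightarrow> DProg V E" using assms(2) by (auto simp: NProg_def)
  have fY: "finite Y" "V \<subseteq> Y" "U1 \<subseteq> Y" "U2 \<subseteq> Y" using assms by auto
  let ?M = "\<lambda>E. sext V Y (dual V E) (ext U2 Y Q)"
  have M: "ext Y X (?M E) = sext V X (dual V E) (ext U2 X Q)" if "Y \<subseteq> X" for X E
    using that fY by (simp add: ext_ext flip: sext_dual_ext)
  have eff: "effect X (ext Y X (?M E))" if "finite X" "Y \<subseteq> X" "E \<in> S" for X E
    using that fY S assms(6) by (auto simp: M intro!: effect_sext_dual proj_ext)
  have "sat_tot S V U1 P U2 Q \<longleftrightarrow> (\<forall>X \<rho>. finite X \<and> Y \<subseteq> X \<and> density X \<rho> \<longrightarrow>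
      Re (tr X (mult X (ext Y X (ext U1 Y P)) \<rho>)) \<le>
      (INF E\<in>S. Re (tr X (mult X (ext Y X (?M E)) \<rho>))))"
  proof -
    have 1: "(INF E\<in>S. Re (tr X (mult X (ext U2 X Q) (sext V X E \<rho>)))) =
        (INF E\<in>S. Re (tr X (mult X (ext Y X (?M E)) \<rho>)))" if "finite X" "Y \<subseteq> X" for X \<rho>
      using that fY S by (intro INF_cong refl) (simp add: M tr_sext_dual)
    have 2: "ext Y X (ext U1 Y P) = ext U1 X P" if "Y \<subseteq> X" for X using that fY by (simp add: ext_ext)
    show ?thesis unfolding sat_tot_def Y[symmetric] by (auto simp: 1 2)
  qed
  also have "\<dots> \<longleftrightarrow> (\<forall>E\<in>S. \<forall>v\<in>rng Y (ext U1 Y P). app Y (?M E) v = v)"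
    using fY S assms(5) eff by (intro sat_effect_iff) (auto intro: proj_ext is_op_sext)
  finally show ?thesis .
qed

text \<open>The partial-correctness expectation is
  \<open>tr \<rho> - tr ((I - Q) E(\<rho>))\<close>, so it is tested by the effect
  \<open>I - E\<^sup>*(I - Q)\<close>; being fixed by this effect means being killed by
  \<open>E\<^sup>*(I - Q)\<close>.\<close>

lemma sat_par_iff:
  assumes "finite V" "NProg V S" "finite U1" "finite U2" "proj U1 P" "proj U2 Q"
    and Y: "Y = V \<union> U1 \<union> U2"
  shows "sat_par S V U1 P U2 Q \<longleftrightarrow> (\<forall>E\<in>S. \<forall>v\<in>rng Y (ext U1 Y P).
    app Y (sext V Y (dual V E) (idop Y - ext U2 Y Q)) v = (\<lambda>_. 0))"
proof -
  have S: "S \<noteq> {}" "\<And>E. E \<in> S \<Longrightarrow> DProg V E" using assms(2) by (auto simp: NProg_def)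
  have fY: "finite Y" "V \<subseteq> Y" "U1 \<subseteq> Y" "U2 \<subseteq> Y" using assms by auto
  let ?N = "\<lambda>E. sext V Y (dual V E) (idop Y - ext U2 Y Q)"
  let ?M = "\<lambda>E. idop Y - ?N E"
  have M: "ext Y X (?M E) = idop X - sext V X (dual V E) (idop X - ext U2 X Q)" if "Y \<subseteq> X" for X E
    using that fY by (simp add: ext_diff ext_idop ext_ext flip: sext_dual_ext)
  have eff: "effect X (ext Y X (?M E))" if "finite X" "Y \<subseteq> X" "E \<in> S" for X E
    using that fY S assms(6)
    by (auto simp: M intro!: effect_compl effect_sext_dual proj_ext proj_compl)
  have "sat_par S V U1 P U2 Q \<longleftrightarrow> (\<forall>X \<rho>. finite X \<and> Y \<subseteq> X \<and> density X \<rho> \<longrightarrow>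
      Re (tr X (mult X (ext Y X (ext U1 Y P)) \<rho>)) \<le>
      (INF E\<in>S. Re (tr X (mult X (ext Y X (?M E)) \<rho>))))"
  proof -
    have 1: "(INF E\<in>S. Re (tr X (mult X (ext U2 X Q) (sext V X E \<rho>))) + Re (tr X \<rho>)
          - Re (tr X (sext V X E \<rho>))) =
        (INF E\<in>S. Re (tr X (mult X (ext Y X (?M E)) \<rho>)))"
      if X: "finite X" "Y \<subseteq> X" "density X \<rho>" for X \<rho>
    proof (intro INF_cong refl)
      fix E assume "E \<in> S"
      then have E: "DProg V E" using S by blast
      have "tr X (mult X (ext Y X (?M E)) \<rho>) =
          tr X \<rho> - tr X (mult X (idop X - ext U2 X Q) (sext V X E \<rho>))"
        unfolding M[OF X(2)] using X fY E
        by (subst tr_sext_dual) (auto simp: mult_diff_left[of X "idop X" "sext _ _ _ _"] tr_diff idop_mult psd_is_op density_def)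
      also have "\<dots> = tr X \<rho> - (tr X (sext V X E \<rho>) - tr X (mult X (ext U2 X Q) (sext V X E \<rho>)))"
        using X by (simp add: mult_diff_left tr_diff idop_mult is_op_sext)
      finally show "Re (tr X (mult X (ext U2 X Q) (sext V X E \<rho>))) + Re (tr X \<rho>)
          - Re (tr X (sext V X E \<rho>)) = Re (tr X (mult X (ext Y X (?M E)) \<rho>))" by simp
    qed
    have 2: "ext Y X (ext U1 Y P) = ext U1 X P" if "Y \<subseteq> X" for X using that fY by (simp add: ext_ext)
    show ?thesis unfolding sat_par_def Y[symmetric] by (auto simp: 1 2)
  qed
  also have "\<dots> \<longleftrightarrow> (\<forall>E\<in>S. \<forall>v\<in>rng Y (ext U1 Y P). app Y (?M E) v = v)"
    using fY S assms(5) eff by (intro sat_effect_iff) (auto intro: proj_ext is_op_sext is_op_diff)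
  also have "\<dots> \<longleftrightarrow> (\<forall>E\<in>S. \<forall>v\<in>rng Y (ext U1 Y P). app Y (?N E) v = (\<lambda>_. 0))"
  proof -
    have "app Y (?M E) v = v \<longleftrightarrow> app Y (?N E) v = (\<lambda>_. 0)" if "v \<in> rng Y (ext U1 Y P)" for E v
    proof -
      have "is_vec Y v" using that fY assms(5) by (simp add: rng_proj proj_ext)
      then show ?thesis using fY(1) by (auto simp: app_diff_op app_idop fun_eq_iff)
    qed
    then show ?thesis by blast
  qed
  finally show ?thesis .
qed

section \<open>The predicate transformers as subspaces\<close>

lemma rng_subset_of_columns:
  assumes "finite X" "subsp X K" "\<And>g. g \<in> B X \<Longrightarrow> (\<lambda>f. A f g) \<in> K"
  shows "rng X A \<subseteq> K"
proof
  fix x assume "x \<in> rng X A"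
  then obtain v where x: "x = app X A v" by (auto simp: rng_def)
  have "(\<lambda>f. \<Sum>g\<in>B X. v g * A f g) \<in> K"
    using assms by (intro subsp_sum) (auto simp: finite_B)
  then show "x \<in> K" by (simp add: x app_def mult.commute)
qed

lemma op_eq_app:
  assumes "finite X" "is_op X A" "is_op X C" "\<And>v. is_vec X v \<Longrightarrow> app X A v = app X C v"
  shows "A = C"
proof (rule op_eqI[OF assms(2,3)])
  fix f g assume *: "f \<in> B X" "g \<in> B X"
  have "is_vec X (\<lambda>h. of_bool (h = g))" using * by (auto simp: is_vec_def)
  then show "A f g = C f g" using assms(4) ip_app_basis[OF assms(1) *] by metis
qed

text \<open>The diagonal entries are nonnegative and sum to 0, so the form vanishes at every basis
  vector and \<open>psd_kernel\<close> kills each column.\<close>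

lemma psd_tr_eq_0:
  assumes "finite X" "psd X D" "Re (tr X D) = 0"
  shows "D = zop"
proof (rule op_eqI[of X])
  fix f g assume *: "f \<in> B X" "g \<in> B X"
  have nn: "0 \<le> Re (D h h)" if "h \<in> B X" for h
    using psd_ip[OF assms(2)] ip_app_basis[OF assms(1) that that] by metis
  have "(\<Sum>h\<in>B X. Re (D h h)) = 0" using assms(3) by (simp add: tr_def)
  then have "Re (D g g) = 0"
    using * nn sum_nonneg_eq_0_iff[OF finite_B[OF assms(1)], of "\<lambda>h. Re (D h h)"] by blast
  then have "app X D (\<lambda>h. of_bool (h = g)) = (\<lambda>_. 0)"
    using * by (intro psd_kernel[OF assms(1,2)]) (simp add: ip_app_basis assms(1))
  then show "D f g = zop f g"
    using ip_app_basis[OF assms(1) *, of D] by (simp add: ip_def zop_def)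
qed (auto simp: psd_is_op assms)

text \<open>The kernel of a hermitian A is the orthogonal complement of its range. Algebraically,
  the left side says \<open>A R = A\<close>, the right side says \<open>R A = A\<close>, and the
  adjoint exchanges the two.\<close>

lemma psd_kernel_iff_rng:
  assumes "finite X" "psd X A" "proj X R"
  shows "(\<forall>w\<in>rng X (idop X - R). app X A w = (\<lambda>_. 0)) \<longleftrightarrow> rng X A \<subseteq> rng X R"
proof
  have A: "is_op X A" "adj A = A" using assms psd_is_op psd_adj by auto
  have R: "is_op X R" "adj R = R" using assms by (auto simp: proj_def)
  {
    assume *: "\<forall>w\<in>rng X (idop X - R). app X A w = (\<lambda>_. 0)"
    have "mult X A R = A"
    proof (rule op_eq_app[OF assms(1)])
      fix v assume v: "is_vec X v"
      have "app X (idop X - R) v \<in> rng X (idop X - R)" using v by (auto simp: rng_def)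
      then have "app X A (app X (idop X - R) v) = (\<lambda>_. 0)" using * by blast
      then have "app X A (v - app X R v) = (\<lambda>_. 0)" using v assms(1) by (simp add: app_diff_op app_idop)
      then show "app X (mult X A R) v = app X A v" by (simp add: app_diff app_mult fun_eq_iff)
    qed (use A R is_op_mult in auto)
    then have "mult X R A = A" using adj_mult[of X A R] A R by simp
    then have "app X R (app X A v) = app X A v" for v using app_mult by metis
    then show "rng X A \<subseteq> rng X R"
      using assms(3) is_vec_app[OF A(1)] by (auto simp: rng_proj rng_def[of X A])
  }
  assume *: "rng X A \<subseteq> rng X R"
  have "mult X R A = A"
  proof (rule op_eq_app[OF assms(1)])
    fix v assume v: "is_vec X v"
    then have "app X A v \<in> rng X R" using * by (auto simp: rng_def)
    then show "app X (mult X R A) v = app X A v" using assms(3) by (simp add: rng_proj app_mult)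
  qed (use A R is_op_mult in auto)
  then have "mult X A R = A" using adj_mult[of X R A] A R by simp
  then have "app X A (app X R w) = app X A w" for w using app_mult by metis
  then show "\<forall>w\<in>rng X (idop X - R). app X A w = (\<lambda>_. 0)"
    using rng_compl[OF assms(1,3)] by (metis (mono_tags, lifting) app_zero mem_Collect_eq)
qed

text \<open>The bridge from the dual to the program itself. With \<open>A = E(|v><v|)\<close> one
  has \<open><v, E\<^sup>*(C) v> = tr (C A) = tr (C A C)\<close>. Positivity makes the left end
  vanish exactly when \<open>E\<^sup>*(C)\<close> kills v, and the right end exactly when A vanishes
  on C.\<close>

lemma sext_dual_kernel_iff:
  assumes "finite Y" "V \<subseteq> Y" "DProg V E" "proj Y C" "is_vec Y v"
  shows "app Y (sext V Y (dual V E) C) v = (\<lambda>_. 0) \<longleftrightarrow>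
    (\<forall>w\<in>rng Y C. app Y (sext V Y E (outer v v)) w = (\<lambda>_. 0))"
proof -
  define A where "A = sext V Y E (outer v v)"
  define M where "M = sext V Y (dual V E) C"
  have A: "psd Y A" using psd_sext[OF assms(1-3) psd_outer[OF assms(5)]] by (simp add: A_def)
  have M: "psd Y M"
    using effect_sext_dual[OF assms(1-4)] pos_fun_psd assms(1) by (auto simp: M_def effect_def)
  have C: "is_op Y C" "adj C = C" "mult Y C C = C" using assms(4) by (auto simp: proj_def)
  have "ip Y v (app Y M v) = tr Y (mult Y C A)"
    using tr_mult_outer[of Y M v] tr_sext_dual[OF assms(1-3), of C "outer v v"] by (simp add: A_def M_def)
  also have tCA: "\<dots> = tr Y (mult Y (mult Y C A) C)"
    using tr_mult_commute[of Y C "mult Y C A"] C(3) by (simp flip: mult_assoc)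
  also have "\<dots> = tr Y (mult Y C (mult Y A (adj C)))" by (simp add: mult_assoc C)
  finally have tr: "ip Y v (app Y M v) = tr Y (mult Y C (mult Y A (adj C)))" .
  have "app Y M v = (\<lambda>_. 0) \<longleftrightarrow> (\<forall>w\<in>rng Y C. app Y A w = (\<lambda>_. 0))"
  proof
    assume "app Y M v = (\<lambda>_. 0)"
    then have "Re (tr Y (mult Y C (mult Y A (adj C)))) = 0" by (simp add: ip_def flip: tr)
    then have D: "mult Y C (mult Y A (adj C)) = zop"
      by (rule psd_tr_eq_0[OF assms(1) psd_conj[OF A C(1)]])
    show "\<forall>w\<in>rng Y C. app Y A w = (\<lambda>_. 0)"
    proof
      fix w assume "w \<in> rng Y C"
      then have w: "app Y C w = w" using assms(4) by (simp add: rng_proj)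
      have "app Y C (app Y A (app Y C w)) = (\<lambda>_. 0)"
        using arg_cong[OF D, of "\<lambda>D. app Y D w"] by (simp add: app_mult C)
      then have "app Y C (app Y A w) = (\<lambda>_. 0)" by (simp add: w)
      \<comment> \<open>C fixes w and is self-adjoint, so
        \<open><w, A w> = <w, C A w>\<close>.\<close>
      then have "ip Y w (app Y A w) = 0"
        using ip_app[of Y w C "app Y A w"] by (simp add: C w ip_def)
      then show "app Y A w = (\<lambda>_. 0)" by (intro psd_kernel[OF assms(1) A]) simp
    qed
  next
    assume *: "\<forall>w\<in>rng Y C. app Y A w = (\<lambda>_. 0)"
    have "mult Y A C = zop"
    proof (intro ext)
      fix f g
      show "mult Y A C f g = zop f g"
        using fun_cong[OF bspec[OF * proj_column[OF assms(4), of g]], of f]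
        by (simp add: app_def mult_def zop_def)
    qed
    then have "ip Y v (app Y M v) = 0"
      unfolding tr C(2) by (simp add: mult_def tr_def zop_def)
    then show "app Y M v = (\<lambda>_. 0)" by (intro psd_kernel[OF assms(1) M]) simp
  qed
  then show ?thesis by (simp add: A_def M_def)
qed

definition wp_space :: "sop set \<Rightarrow> nat set \<Rightarrow> nat set \<Rightarrow> op \<Rightarrow> (asg \<Rightarrow> complex) set" where
  "wp_space S V Y Q = {v. is_vec Y v \<and> (\<forall>E\<in>S. app Y (sext V Y (dual V E) Q) v = v)}"

definition wlp_space :: "sop set \<Rightarrow> nat set \<Rightarrow> nat set \<Rightarrow> op \<Rightarrow> (asg \<Rightarrow> complex) set" where
  "wlp_space S V Y Q =
    {v. is_vec Y v \<and> (\<forall>E\<in>S. app Y (sext V Y (dual V E) (idop Y - Q)) v = (\<lambda>_. 0))}"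

lemma subsp_wp_space: "subsp Y (wp_space S V Y Q)"
  by (auto simp: subsp_def wp_space_def app_add app_scale) (auto simp: is_vec_def)

lemma subsp_wlp_space: "subsp Y (wlp_space S V Y Q)"
  by (auto simp: subsp_def wlp_space_def app_add app_scale) (auto simp: is_vec_def)

text \<open>In this forward form Q enters only as an upper bound for ranges, which makes
  monotonicity and preservation of meets matters of plain set theory.\<close>

lemma wlp_space_iff:
  assumes "finite Y" "V \<subseteq> Y" "NProg V S" "proj Y Q"
  shows "v \<in> wlp_space S V Y Q \<longleftrightarrow>
    is_vec Y v \<and> (\<forall>E\<in>S. rng Y (sext V Y E (outer v v)) \<subseteq> rng Y Q)"
proof -
  have "app Y (sext V Y (dual V E) (idop Y - Q)) v = (\<lambda>_. 0) \<longleftrightarrow>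
      rng Y (sext V Y E (outer v v)) \<subseteq> rng Y Q" if "E \<in> S" "is_vec Y v" for E
  proof -
    have E: "DProg V E" using assms(3) that by (auto simp: NProg_def)
    show ?thesis
      using sext_dual_kernel_iff[OF assms(1,2) E proj_compl[OF assms(1,4)] that(2)]
        psd_kernel_iff_rng[OF assms(1) psd_sext[OF assms(1,2) E psd_outer[OF that(2)]] assms(4)]
      by simp
  qed
  then show ?thesis by (auto simp: wlp_space_def)
qed

lemma wlp_space_mono:
  assumes "finite Y" "V \<subseteq> Y" "NProg V S" "proj Y P" "proj Y Q" "psub Y P Q"
  shows "wlp_space S V Y P \<subseteq> wlp_space S V Y Q"
  using assms(6) unfolding psub_def
  by (simp add: subset_iff[of "wlp_space _ _ _ _"] wlp_space_iff[OF assms(1-3)] assms(4,5)) blast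

lemma wlp_space_pmeet:
  assumes "finite Y" "V \<subseteq> Y" "NProg V S" "proj Y P" "proj Y Q"
  shows "wlp_space S V Y (pmeet Y P Q) = wlp_space S V Y P \<inter> wlp_space S V Y Q"
  using assms by (auto simp: wlp_space_iff proj_pmeet rng_pmeet)

text \<open>\<open>I - E\<^sup>*(Q)\<close> is the sum of the positive operators
  \<open>E\<^sup>*(I - Q)\<close> and \<open>I - E\<^sup>*(I)\<close>. If the form of the sum
  vanishes at v, so do both summands, and each of them kills v.\<close>

lemma wp_space_eq:
  assumes "finite Y" "V \<subseteq> Y" "NProg V S" "proj Y Q"
  shows "wp_space S V Y Q = wlp_space S V Y Q \<inter> wp_space S V Y (idop Y)"
proof -
  have "app Y (sext V Y (dual V E) Q) v = v \<longleftrightarrow>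
      app Y (sext V Y (dual V E) (idop Y - Q)) v = (\<lambda>_. 0) \<and> app Y (sext V Y (dual V E) (idop Y)) v = v"
    if "E \<in> S" "is_vec Y v" for E v
  proof
    have E: "DProg V E" using assms(3) that by (auto simp: NProg_def)
    define M where "M = sext V Y (dual V E)"
    have d: "app Y (M (idop Y - Q)) v = app Y (M (idop Y)) v - app Y (M Q) v"
      by (simp add: M_def sext_dual_diff app_diff_op)
    {
      assume "app Y (sext V Y (dual V E) Q) v = v"
      then have fix_v: "app Y (M Q) v = v" by (simp add: M_def)
      have N: "psd Y (M (idop Y - Q))" and I: "psd Y (idop Y - M (idop Y))"
        using effect_sext_dual[OF assms(1,2) E proj_compl[OF assms(1,4)]]
          effect_sext_dual[OF assms(1,2) E proj_idop[OF assms(1)]] pos_fun_psd assms(1)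
        by (auto simp: effect_def M_def)
      have "ip Y v (app Y (M (idop Y - Q)) v) + ip Y v (app Y (idop Y - M (idop Y)) v) = 0"
        unfolding d using app_idop[OF assms(1) that(2)]
        by (simp add: fix_v app_diff_op ip_diff_right)
      then have "Re (ip Y v (app Y (M (idop Y - Q)) v)) + Re (ip Y v (app Y (idop Y - M (idop Y)) v)) = 0"
        by (metis plus_complex.sel(1) zero_complex.sel(1))
      then have "Re (ip Y v (app Y (M (idop Y - Q)) v)) = 0"
        using psd_ip[OF N, of v] psd_ip[OF I, of v] by linarith
      then have "app Y (M (idop Y - Q)) v = (\<lambda>_. 0)" by (rule psd_kernel[OF assms(1) N])
      moreover from this have "app Y (M (idop Y)) v = v" using d fix_v by (simp add: fun_eq_iff)
      ultimately show "app Y (sext V Y (dual V E) (idop Y - Q)) v = (\<lambda>_. 0) \<and>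
        app Y (sext V Y (dual V E) (idop Y)) v = v" by (simp add: M_def)
    }
    assume "app Y (sext V Y (dual V E) (idop Y - Q)) v = (\<lambda>_. 0) \<and>
        app Y (sext V Y (dual V E) (idop Y)) v = v"
    then have "app Y (M (idop Y - Q)) v = (\<lambda>_. 0)" "app Y (M (idop Y)) v = v" by (auto simp: M_def)
    then have "app Y (M Q) v = v" using d by (simp add: fun_eq_iff)
    then show "app Y (sext V Y (dual V E) Q) v = v" by (simp add: M_def)
  qed
  then show ?thesis by (auto simp: wp_space_def wlp_space_def)
qed

text \<open>Resolves the definite descriptions behind wp and wlp: once satisfaction means lying in a
  fixed subspace K, the projector onto K is the largest solution, and antisymmetry makes it
  unique.\<close>

lemma largest_proj_eq:
  assumes "finite Y" "subsp Y K" "\<And>P. proj Y P \<Longrightarrow> sat P \<longleftrightarrow> rng Y P \<subseteq> K"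
    and T: "T = (THE P. proj Y P \<and> sat P \<and> (\<forall>P'. proj Y P' \<and> sat P' \<longrightarrow> psub Y P' P))"
  shows "proj Y T \<and> rng Y T = K"
proof -
  obtain P where P: "proj Y P" "rng Y P = K" using proj_exists assms(1,2) by blast
  have "T = P" unfolding T
  proof (rule the_equality)
    show "proj Y P \<and> sat P \<and> (\<forall>P'. proj Y P' \<and> sat P' \<longrightarrow> psub Y P' P)"
      using P assms(3) by (auto simp: psub_def)
    fix P' assume *: "proj Y P' \<and> sat P' \<and> (\<forall>P''. proj Y P'' \<and> sat P'' \<longrightarrow> psub Y P'' P')"
    then show "P' = P" using P assms(3) by (intro psub_antisym[of Y]) (auto simp: psub_def)
  qed
  then show ?thesis using P by simp
qed

lemma wp_props:
  assumes "finite V" "NProg V S" "finite U" "proj U Q"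
  shows proj_wp: "proj (V \<union> U) (wp S V U Q)"
    and rng_wp: "rng (V \<union> U) (wp S V U Q) = wp_space S V (V \<union> U) (ext U (V \<union> U) Q)"
proof -
  have Y: "V \<union> (V \<union> U) \<union> U = V \<union> U" by blast
  have fin: "finite (V \<union> U)" using assms by blast
  have "sat_tot S V (V \<union> U) P U Q \<longleftrightarrow> rng (V \<union> U) P \<subseteq> wp_space S V (V \<union> U) (ext U (V \<union> U) Q)"
    if "proj (V \<union> U) P" for P
    using sat_tot_iff[OF assms(1,2) fin assms(3) that assms(4) refl] rng_proj[OF that] ext_self[OF proj_is_op[OF that]]
    unfolding Y by (auto simp: wp_space_def)
  from largest_proj_eq[OF fin subsp_wp_space this wp_def]
  show "proj (V \<union> U) (wp S V U Q)"
    "rng (V \<union> U) (wp S V U Q) = wp_space S V (V \<union> U) (ext U (V \<union> U) Q)" by blast+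
qed

lemma wlp_props:
  assumes "finite V" "NProg V S" "finite U" "proj U Q"
  shows proj_wlp: "proj (V \<union> U) (wlp S V U Q)"
    and rng_wlp: "rng (V \<union> U) (wlp S V U Q) = wlp_space S V (V \<union> U) (ext U (V \<union> U) Q)"
proof -
  have Y: "V \<union> (V \<union> U) \<union> U = V \<union> U" by blast
  have fin: "finite (V \<union> U)" using assms by blast
  have "sat_par S V (V \<union> U) P U Q \<longleftrightarrow> rng (V \<union> U) P \<subseteq> wlp_space S V (V \<union> U) (ext U (V \<union> U) Q)"
    if "proj (V \<union> U) P" for P
    using sat_par_iff[OF assms(1,2) fin assms(3) that assms(4) refl] rng_proj[OF that] ext_self[OF proj_is_op[OF that]]
    unfolding Y by (auto simp: wlp_space_def)
  from largest_proj_eq[OF fin subsp_wlp_space this wlp_def]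
  show "proj (V \<union> U) (wlp S V U Q)"
    "rng (V \<union> U) (wlp S V U Q) = wlp_space S V (V \<union> U) (ext U (V \<union> U) Q)" by blast+
qed

text \<open>Via \<open>sext_dual_kernel_iff\<close>, R is a valid postcondition iff its complement
  lies in a subspace L depending on P alone. A smallest R is therefore the complement of the
  projector onto L. \<open>sp_psub_iff\<close> is the adjunction with wlp.\<close>

lemma sp_props:
  assumes "finite V" "NProg V S" "finite U" "proj U P"
  shows proj_sp: "proj (V \<union> U) (sp S V U P)"
    and sp_psub_iff: "proj (V \<union> U) R \<Longrightarrow> psub (V \<union> U) (sp S V U P) R \<longleftrightarrow>
      rng (V \<union> U) (ext U (V \<union> U) P) \<subseteq> wlp_space S V (V \<union> U) R"
proof -
  define Y where "Y = V \<union> U"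
  have Y: "V \<union> U \<union> Y = Y" "finite Y" "V \<subseteq> Y" "U \<subseteq> Y" using assms by (auto simp: Y_def)
  define A where "A = ext U Y P"
  have A: "proj Y A" using Y assms by (simp add: A_def proj_ext)
  have S: "DProg V E" if "E \<in> S" for E using assms(2) that by (auto simp: NProg_def)
  \<comment> \<open>L collects what no output can reach: the common kernel of all
    \<open>E(|v><v|)\<close> with v in the precondition.\<close>
  define L where "L = {w. is_vec Y w \<and>
    (\<forall>E\<in>S. \<forall>v\<in>rng Y A. app Y (sext V Y E (outer v v)) w = (\<lambda>_. 0))}"
  have "subsp Y L"
    by (auto simp: subsp_def L_def app_add app_scale) (auto simp: is_vec_def)
  then obtain C where C: "proj Y C" "rng Y C = L" using proj_exists Y(2) by blast
  have sat: "sat_par S V U P Y R \<longleftrightarrow> rng Y A \<subseteq> wlp_space S V Y R" if "proj Y R" for R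
    using sat_par_iff[OF assms(1,2,3) Y(2) assms(4) that Y(1)[symmetric]] rng_proj[OF A]
      ext_self[OF proj_is_op[OF that]] by (auto simp: wlp_space_def A_def)
  have key: "rng Y A \<subseteq> wlp_space S V Y R \<longleftrightarrow> psub Y (idop Y - C) R" if R: "proj Y R" for R
  proof -
    have "rng Y A \<subseteq> wlp_space S V Y R \<longleftrightarrow> rng Y (idop Y - R) \<subseteq> L"
    proof -
      have "v \<in> wlp_space S V Y R \<longleftrightarrow> (\<forall>E\<in>S. \<forall>w\<in>rng Y (idop Y - R).
          app Y (sext V Y E (outer v v)) w = (\<lambda>_. 0))" if "v \<in> rng Y A" for v
        using sext_dual_kernel_iff[OF Y(2,3) S proj_compl[OF Y(2) R], of _ v] that rng_proj[OF A]
        by (auto simp: wlp_space_def)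
      moreover have "is_vec Y w" if "w \<in> rng Y (idop Y - R)" for w
        using that rng_proj[OF proj_compl[OF Y(2) R]] by simp
      ultimately show ?thesis unfolding L_def by blast
    qed
    also have "\<dots> \<longleftrightarrow> psub Y (idop Y - R) (idop Y - (idop Y - C))"
      unfolding psub_def compl_compl C ..
    also have "\<dots> \<longleftrightarrow> psub Y (idop Y - C) R"
      using R C Y(2) by (intro psub_compl_iff) (auto intro: proj_compl)
    finally show ?thesis .
  qed
  have P0: "proj Y (idop Y - C)" using C Y(2) proj_compl by blast
  have sp: "sp S V U P = idop Y - C"
    unfolding sp_def Y_def[symmetric]
  proof (rule the_equality)
    show "proj Y (idop Y - C) \<and> sat_par S V U P Y (idop Y - C) \<and>
      (\<forall>R'. proj Y R' \<and> sat_par S V U P Y R' \<longrightarrow> psub Y (idop Y - C) R')"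
      using P0 sat key by auto
    fix R assume "proj Y R \<and> sat_par S V U P Y R \<and>
      (\<forall>R'. proj Y R' \<and> sat_par S V U P Y R' \<longrightarrow> psub Y R R')"
    then show "R = idop Y - C" using P0 sat key by (intro psub_antisym[of Y]) auto
  qed
  show "proj (V \<union> U) (sp S V U P)" using P0 sp by (simp add: Y_def)
  show "psub (V \<union> U) (sp S V U P) R \<longleftrightarrow>
      rng (V \<union> U) (ext U (V \<union> U) P) \<subseteq> wlp_space S V (V \<union> U) R" if "proj (V \<union> U) R"
    using key that sp by (simp add: Y_def A_def)
qed

section \<open>Tensoring with a projector on a disjoint register\<close>

text \<open>A vector fixed by \<open>M \<otimes> R\<close> lies in the range of
  \<open>I \<otimes> R\<close>, because that projector absorbs \<open>M \<otimes> R\<close> from the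
  left. On this range \<open>M \<otimes> R\<close> and \<open>M \<otimes> I\<close> agree.\<close>

lemma app_tensor_eq_self_iff:
  assumes "Y \<inter> Z = {}" "finite Y" "finite Z" "is_op Y M" "proj Z R"
  shows "app (Y \<union> Z) (tensor Y Z M R) v = v \<longleftrightarrow>
    app (Y \<union> Z) (tensor Y Z M (idop Z)) v = v \<and> app (Y \<union> Z) (tensor Y Z (idop Y) R) v = v"
proof -
  have R: "is_op Z R" "mult Z R R = R" using assms(5) by (auto simp: proj_def)
  have 1: "tensor Y Z M R = mult (Y \<union> Z) (tensor Y Z M (idop Z)) (tensor Y Z (idop Y) R)"
    using assms R by (simp add: mult_tensor mult_idop idop_mult)
  have 2: "tensor Y Z M R = mult (Y \<union> Z) (tensor Y Z (idop Y) R) (tensor Y Z M R)"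
    using assms R by (simp add: mult_tensor mult_idop idop_mult)
  show ?thesis using 1 2 app_mult by metis
qed

lemma rng_tensor_iff:
  assumes "Y \<inter> Z = {}" "finite Y" "finite Z" "proj Y A" "proj Z R"
  shows "v \<in> rng (Y \<union> Z) (tensor Y Z A R) \<longleftrightarrow> is_vec (Y \<union> Z) v \<and>
    (\<forall>b\<in>B Z. vslice Y b v \<in> rng Y A) \<and> app (Y \<union> Z) (tensor Y Z (idop Y) R) v = v"
proof -
  have A: "is_op Y A" using assms(4) by (rule proj_is_op)
  show ?thesis
    unfolding rng_proj[OF proj_tensor[OF assms(1,4,5)]] rng_proj[OF assms(4)] mem_Collect_eq
      app_tensor_eq_self_iff[OF assms(1-3) A assms(5)]
    using app_tensor_idop_eq_self_iff[OF assms(1,3) A] is_vec_vslice by blast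
qed

lemma wp_space_tensor:
  assumes "Y \<inter> Z = {}" "finite Y" "finite Z" "V \<subseteq> Y" "S \<noteq> {}" "proj Z R"
    and A: "proj Y A" "rng Y A = wp_space S V Y Q"
  shows "wp_space S V (Y \<union> Z) (tensor Y Z Q R) = rng (Y \<union> Z) (tensor Y Z A R)"
proof -
  have "v \<in> wp_space S V (Y \<union> Z) (tensor Y Z Q R) \<longleftrightarrow> v \<in> rng (Y \<union> Z) (tensor Y Z A R)"
    if v: "is_vec (Y \<union> Z) v" for v
  proof -
    have "v \<in> wp_space S V (Y \<union> Z) (tensor Y Z Q R) \<longleftrightarrow>
        (\<forall>E\<in>S. app (Y \<union> Z) (tensor Y Z (sext V Y (dual V E) Q) R) v = v)"
      using v assms by (simp add: wp_space_def sext_tensor dual_scale)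
    also have "\<dots> \<longleftrightarrow> (\<forall>E\<in>S. \<forall>b\<in>B Z. app Y (sext V Y (dual V E) Q) (vslice Y b v) = vslice Y b v) \<and>
        app (Y \<union> Z) (tensor Y Z (idop Y) R) v = v"
      unfolding app_tensor_eq_self_iff[OF assms(1-3) is_op_sext assms(6)]
        app_tensor_idop_eq_self_iff[OF assms(1,3) is_op_sext v]
      \<comment> \<open>The condition on R does not depend on E; it can be pulled out of the
        quantifier because S is nonempty.\<close>
      using assms(5) by blast
    also have "\<dots> \<longleftrightarrow> v \<in> rng (Y \<union> Z) (tensor Y Z A R)"
      using v A(2) assms(5) by (auto simp: rng_tensor_iff[OF assms(1-3) A(1) assms(6)] wp_space_def)
    finally show ?thesis .
  qed
  moreover have "is_vec (Y \<union> Z) v" if "v \<in> rng (Y \<union> Z) (tensor Y Z A R)" for v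
    using that by (simp add: rng_tensor_iff[OF assms(1-3) A(1) assms(6)])
  ultimately show ?thesis by (auto simp: wp_space_def)
qed

text \<open>On vectors fixed by \<open>I \<otimes> R\<close> the operator
  \<open>E\<^sup>*(I - Q \<otimes> R)\<close> acts as \<open>E\<^sup>*(I - Q) \<otimes> I\<close>,
  whose kernel is tested slice by slice.\<close>

lemma wlp_space_tensor:
  assumes "Y \<inter> Z = {}" "finite Y" "finite Z" "V \<subseteq> Y" "proj Z R"
    and A: "proj Y A" "rng Y A \<subseteq> wlp_space S V Y Q"
  shows "rng (Y \<union> Z) (tensor Y Z A R) \<subseteq> wlp_space S V (Y \<union> Z) (tensor Y Z Q R)"
proof
  fix v assume "v \<in> rng (Y \<union> Z) (tensor Y Z A R)"
  then have v: "is_vec (Y \<union> Z) v" "\<And>b. b \<in> B Z \<Longrightarrow> vslice Y b v \<in> rng Y A"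
    "app (Y \<union> Z) (tensor Y Z (idop Y) R) v = v"
    using rng_tensor_iff[OF assms(1-3) A(1) assms(5)] by blast+
  have R: "is_op Z R" using assms(5) by (simp add: proj_def)
  have "app (Y \<union> Z) (sext V (Y \<union> Z) (dual V E) (idop (Y \<union> Z) - tensor Y Z Q R)) v = (\<lambda>_. 0)"
    if "E \<in> S" for E
  proof -
    define M where "M = sext V Y (dual V E)"
    have M: "is_op Y (M C)" for C by (simp add: M_def is_op_sext)
    have "sext V (Y \<union> Z) (dual V E) (idop (Y \<union> Z) - tensor Y Z Q R) =
        tensor Y Z (M (idop Y)) (idop Z) - tensor Y Z (M Q) R"
      using assms by (simp add: sext_dual_diff sext_tensor dual_scale M_def flip: tensor_idop)
    moreover have "tensor Y Z (M Q) R = mult (Y \<union> Z) (tensor Y Z (M Q) (idop Z)) (tensor Y Z (idop Y) R)"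
      using assms R M by (simp add: mult_tensor mult_idop idop_mult)
    ultimately have "app (Y \<union> Z) (sext V (Y \<union> Z) (dual V E) (idop (Y \<union> Z) - tensor Y Z Q R)) v =
        app (Y \<union> Z) (tensor Y Z (M (idop Y - Q)) (idop Z)) v"
      by (simp add: app_diff_op app_mult v(3) M_def sext_dual_diff tensor_diff_left)
    also have "\<dots> = (\<lambda>_. 0)"
      using v(2) A(2) that assms(1,3) by (subst app_tensor_idop_eq_0_iff) (auto simp: M M_def wlp_space_def is_op_sext)
    finally show ?thesis .
  qed
  then show "v \<in> wlp_space S V (Y \<union> Z) (tensor Y Z Q R)" using v(1) by (simp add: wlp_space_def)
qed

section \<open>Product vectors\<close>

definition tvec ::
  "nat set \<Rightarrow> nat set \<Rightarrow> (asg \<Rightarrow> complex) \<Rightarrow> (asg \<Rightarrow> complex) \<Rightarrow> asg \<Rightarrow> complex" where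
  "tvec Y Z u r = (\<lambda>f. if f \<in> B (Y \<union> Z) then u (restr Y f) * r (restr Z f) else 0)"

lemma is_vec_tvec [simp]: "is_vec (Y \<union> Z) (tvec Y Z u r)"
  by (simp add: is_vec_def tvec_def)

lemma outer_tvec: "outer (tvec Y Z u r) (tvec Y Z u r) = tensor Y Z (outer u u) (outer r r)"
  by (auto simp: outer_def tvec_def tensor_def fun_eq_iff)

lemma app_tensor_tvec:
  assumes "Y \<inter> Z = {}"
  shows "app (Y \<union> Z) (tensor Y Z A C) (tvec Y Z u r) = tvec Y Z (app Y A u) (app Z C r)"
proof (rule vec_eqI[of "Y \<union> Z"])
  fix f assume "f \<in> B (Y \<union> Z)"
  then obtain a b where *: "a \<in> B Y" "b \<in> B Z" "f = merge Y a b" by (rule B_Un_cases)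
  have "app (Y \<union> Z) (tensor Y Z A C) (tvec Y Z u r) f =
      (\<Sum>x\<in>B Y. \<Sum>y\<in>B Z. (A a x * u x) * (C b y * r y))"
    unfolding app_def sum_B_Un[OF assms] using * assms
    by (simp add: tensor_merge tvec_def merge_in_B restr_merge1 restr_merge2 mult_ac)
  also have "\<dots> = tvec Y Z (app Y A u) (app Z C r) f"
    using * assms by (simp add: tvec_def merge_in_B restr_merge1 restr_merge2 app_def sum_product)
  finally show "app (Y \<union> Z) (tensor Y Z A C) (tvec Y Z u r) f = tvec Y Z (app Y A u) (app Z C r) f" .
qed (auto simp: is_vec_app is_op_tensor)

text \<open>The columns of \<open>A \<otimes> R\<close> are products of columns of A and of R, so a
  subspace contains the whole range once it contains these product vectors.\<close>

lemma rng_tensor_subset: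
  assumes "Y \<inter> Z = {}" "finite Y" "finite Z" "proj Y A" "proj Z R" "subsp (Y \<union> Z) K"
    and K: "\<And>u r. u \<in> rng Y A \<Longrightarrow> r \<in> rng Z R \<Longrightarrow> tvec Y Z u r \<in> K"
  shows "rng (Y \<union> Z) (tensor Y Z A R) \<subseteq> K"
proof (rule rng_subset_of_columns)
  fix g assume "g \<in> B (Y \<union> Z)"
  then have "(\<lambda>f. tensor Y Z A R f g) = tvec Y Z (\<lambda>f. A f (restr Y g)) (\<lambda>f. R f (restr Z g))"
    by (simp add: tensor_def tvec_def)
  then show "(\<lambda>f. tensor Y Z A R f g) \<in> K" using K proj_column assms(4,5) by simp
qed (use assms in auto)

text \<open>The lower bound for the strongest postcondition of P \<otimes> R: for a fixed r in R, the
  vectors u such that u \<otimes> r lies in a postcondition T of P \<otimes> R form a postcondition of P,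
  because E sends |v><v| \<otimes> |r><r| to E(|v><v|) \<otimes> |r><r|.\<close>

lemma wlp_space_tensor_factor:
  assumes "Y \<inter> Z = {}" "finite Y" "finite Z" "V \<subseteq> Y" "NProg V S" "proj Y A" "proj Z R" "proj (Y \<union> Z) T"
    and sat: "rng (Y \<union> Z) (tensor Y Z A R) \<subseteq> wlp_space S V (Y \<union> Z) T"
    and r: "r \<in> rng Z R"
  obtains C where "proj Y C" "rng Y C = {u. is_vec Y u \<and> tvec Y Z u r \<in> rng (Y \<union> Z) T}"
    "rng Y A \<subseteq> wlp_space S V Y C"
proof -
  let ?K = "{u. is_vec Y u \<and> tvec Y Z u r \<in> rng (Y \<union> Z) T}"
  have T: "subsp (Y \<union> Z) (rng (Y \<union> Z) T)" using assms(8) subsp_rng by blast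
  have zero: "tvec Y Z (\<lambda>_. 0) q = (\<lambda>_. 0)" "tvec Y Z q (\<lambda>_. 0) = (\<lambda>_. 0)" for q
    by (simp_all add: tvec_def fun_eq_iff)
  have add: "tvec Y Z (\<lambda>f. u f + v f) r = (\<lambda>f. tvec Y Z u r f + tvec Y Z v r f)" for u v
    by (simp add: tvec_def fun_eq_iff distrib_right)
  have scale: "tvec Y Z (\<lambda>f. c * u f) r = (\<lambda>f. c * tvec Y Z u r f)"
    "tvec Y Z u (\<lambda>f. c * r f) = (\<lambda>f. c * tvec Y Z u r f)" for c u
    by (simp_all add: tvec_def fun_eq_iff)
  have T0: "(\<lambda>_. 0) \<in> rng (Y \<union> Z) T" using T by (simp add: subsp_def)
  have "subsp Y ?K"
    unfolding subsp_def
    by (auto simp: zero add scale T0 intro!: subsp_add[OF T] subsp_scale[OF T]) (auto simp: is_vec_def)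
  then obtain C where C: "proj Y C" "rng Y C = ?K" using proj_exists assms(2) by blast
  have fin: "finite (Y \<union> Z)" "V \<subseteq> Y \<union> Z" using assms by auto
  have "rng Y A \<subseteq> wlp_space S V Y C"
  proof
    fix v assume v: "v \<in> rng Y A"
    have vv: "is_vec Y v" "app Y A v = v" using v assms(6) by (auto simp: rng_proj)
    have rr: "app Z R r = r" using r assms(7) by (auto simp: rng_proj)
    have "tvec Y Z v r \<in> rng (Y \<union> Z) (tensor Y Z A R)"
      using rng_proj[OF proj_tensor[OF assms(1,6,7)]] by (simp add: app_tensor_tvec[OF assms(1)] vv rr)
    then have "tvec Y Z v r \<in> wlp_space S V (Y \<union> Z) T" using sat by blast
    then have sub: "rng (Y \<union> Z) (sext V (Y \<union> Z) E (tensor Y Z (outer v v) (outer r r))) \<subseteq> rng (Y \<union> Z) T"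
      if "E \<in> S" for E
      using that by (simp add: wlp_space_iff[OF fin assms(5,8)] outer_tvec)
    have "rng Y (sext V Y E (outer v v)) \<subseteq> rng Y C" if E: "E \<in> S" for E
    proof
      fix x assume "x \<in> rng Y (sext V Y E (outer v v))"
      then obtain w where w: "is_vec Y w" "x = app Y (sext V Y E (outer v v)) w"
        by (auto simp: rng_def)
      have x: "is_vec Y x" by (simp add: w is_vec_app is_op_sext)
      have "tvec Y Z x r \<in> rng (Y \<union> Z) T"
      \<comment> \<open>Applying \<open>|r><r|\<close> to r leaves the factor \<open><r, r>\<close>,
        which is divided out; this needs r to be nonzero.\<close>
      proof (cases "r = (\<lambda>_. 0)")
        case True
        then show ?thesis by (simp add: zero T0)
      next
        case False
        then have n: "ip Z r r \<noteq> 0" using ip_self_eq_0[OF assms(3)] r rng_proj[OF assms(7)] by blast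
        have "DProg V E" using E assms(5) by (auto simp: NProg_def)
        then have "sext V (Y \<union> Z) E (tensor Y Z (outer v v) (outer r r)) =
            tensor Y Z (sext V Y E (outer v v)) (outer r r)"
          using assms(1,4) by (intro sext_tensor) (auto simp: DProg_scale)
        then have "app (Y \<union> Z) (tensor Y Z (sext V Y E (outer v v)) (outer r r)) (tvec Y Z w r)
            \<in> rng (Y \<union> Z) T"
          using sub[OF E] by (force simp: rng_def[of _ "tensor _ _ _ _"])
        then have "(\<lambda>f. ip Z r r * tvec Y Z x r f) \<in> rng (Y \<union> Z) T"
          by (simp add: app_tensor_tvec[OF assms(1)] w app_outer scale)
        then have "(\<lambda>f. (1 / ip Z r r) * (ip Z r r * tvec Y Z x r f)) \<in> rng (Y \<union> Z) T"
          by (rule subsp_scale[OF T])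
        then show ?thesis using n by simp
      qed
      then show "x \<in> rng Y C" using x C by simp
    qed
    then show "v \<in> wlp_space S V Y C"
      using vv by (simp add: wlp_space_iff[OF assms(2,4,5) C(1)])
  qed
  then show thesis using that C by blast
qed

lemma wp_tensor:
  assumes "finite V" "NProg V S" "finite W" "proj W Q"
    and Z: "finite Z" "Z \<inter> (V \<union> W) = {}" "proj Z R"
  shows "wp S V (W \<union> Z) (tensor W Z Q R) = tensor (V \<union> W) Z (wp S V W Q) R"
proof -
  have disj: "W \<inter> Z = {}" "(V \<union> W) \<inter> Z = {}" using Z by auto
  have T: "proj (W \<union> Z) (tensor W Z Q R)" using proj_tensor disj assms(4) Z(3) by blast
  have Y: "V \<union> (W \<union> Z) = V \<union> W \<union> Z" by blast
  have ext: "ext (W \<union> Z) (V \<union> W \<union> Z) (tensor W Z Q R) = tensor (V \<union> W) Z (ext W (V \<union> W) Q) R"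
    using disj by (intro ext_tensor) auto
  note wpW = wp_props[OF assms(1-4)]
  note wpT = wp_props[OF assms(1,2) finite_UnI[OF assms(3) Z(1)] T, unfolded Y ext]
  have "wp_space S V (V \<union> W \<union> Z) (tensor (V \<union> W) Z (ext W (V \<union> W) Q) R) =
      rng (V \<union> W \<union> Z) (tensor (V \<union> W) Z (wp S V W Q) R)"
    using wpW disj assms Z by (intro wp_space_tensor) (auto simp: NProg_def)
  then show ?thesis
    using wpT proj_tensor[OF disj(2) wpW(1) Z(3)] by (intro proj_eqI[of "V \<union> W \<union> Z"]) auto
qed

lemma wlp_tensor:
  assumes "finite V" "NProg V S" "finite W" "proj W Q"
    and Z: "finite Z" "Z \<inter> (V \<union> W) = {}" "proj Z R"
  shows "psub (V \<union> W \<union> Z) (tensor (V \<union> W) Z (wlp S V W Q) R) (wlp S V (W \<union> Z) (tensor W Z Q R))"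
proof -
  have disj: "W \<inter> Z = {}" "(V \<union> W) \<inter> Z = {}" using Z by auto
  have T: "proj (W \<union> Z) (tensor W Z Q R)" using proj_tensor disj assms(4) Z(3) by blast
  have Y: "V \<union> (W \<union> Z) = V \<union> W \<union> Z" by blast
  have ext: "ext (W \<union> Z) (V \<union> W \<union> Z) (tensor W Z Q R) = tensor (V \<union> W) Z (ext W (V \<union> W) Q) R"
    using disj by (intro ext_tensor) auto
  note wlpW = wlp_props[OF assms(1-4)]
  note wlpT = wlp_props[OF assms(1,2) finite_UnI[OF assms(3) Z(1)] T, unfolded Y ext]
  show ?thesis
    unfolding psub_def wlpT(2) using wlpW disj assms Z by (intro wlp_space_tensor) auto
qed

text \<open>\<open>wlp_space_tensor\<close> makes \<open>sp P \<otimes> R\<close> a valid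
  postcondition of \<open>P \<otimes> R\<close>, hence an upper bound. For the converse it is enough
  to place each product vector in the true strongest postcondition.\<close>

lemma sp_tensor:
  assumes "finite V" "NProg V S" "finite W" "proj W P"
    and Z: "finite Z" "Z \<inter> (V \<union> W) = {}" "proj Z R"
  shows "sp S V (W \<union> Z) (tensor W Z P R) = tensor (V \<union> W) Z (sp S V W P) R"
proof -
  have disj: "W \<inter> Z = {}" "(V \<union> W) \<inter> Z = {}" using Z by auto
  have PR: "proj (W \<union> Z) (tensor W Z P R)" using proj_tensor disj assms(4) Z(3) by blast
  have Y: "V \<union> (W \<union> Z) = V \<union> W \<union> Z" by blast
  have fin: "finite (V \<union> W)" and VY: "V \<subseteq> V \<union> W" using assms by auto
  have ext: "ext (W \<union> Z) (V \<union> W \<union> Z) (tensor W Z P R) = tensor (V \<union> W) Z (ext W (V \<union> W) P) R"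
    using disj by (intro ext_tensor) auto
  define A where "A = ext W (V \<union> W) P"
  have A: "proj (V \<union> W) A" using assms by (simp add: A_def proj_ext)
  define T where "T = sp S V (W \<union> Z) (tensor W Z P R)"
  note spW = sp_props[OF assms(1-4), folded A_def]
  note spT = sp_props[OF assms(1,2) finite_UnI[OF assms(3) Z(1)] PR, unfolded Y ext, folded A_def T_def]
  have N: "proj (V \<union> W \<union> Z) (tensor (V \<union> W) Z (sp S V W P) R)"
    by (rule proj_tensor[OF disj(2) spW(1) Z(3)])
  have "rng (V \<union> W) A \<subseteq> wlp_space S V (V \<union> W) (sp S V W P)"
    using spW(2)[OF spW(1)] by simp
  then have "psub (V \<union> W \<union> Z) T (tensor (V \<union> W) Z (sp S V W P) R)"
    unfolding spT(2)[OF N] using wlp_space_tensor[OF disj(2) fin Z(1) VY Z(3) A] by blast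
  moreover have "psub (V \<union> W \<union> Z) (tensor (V \<union> W) Z (sp S V W P) R) T"
    unfolding psub_def
  proof (rule rng_tensor_subset[OF disj(2) fin Z(1) spW(1) Z(3) subsp_rng[OF spT(1)]])
    fix u r assume u: "u \<in> rng (V \<union> W) (sp S V W P)" and r: "r \<in> rng Z R"
    have sat: "rng (V \<union> W \<union> Z) (tensor (V \<union> W) Z A R) \<subseteq> wlp_space S V (V \<union> W \<union> Z) T"
      using spT(2)[OF spT(1)] by simp
    obtain C where C: "proj (V \<union> W) C"
      "rng (V \<union> W) C = {u. is_vec (V \<union> W) u \<and> tvec (V \<union> W) Z u r \<in> rng (V \<union> W \<union> Z) T}"
      "rng (V \<union> W) A \<subseteq> wlp_space S V (V \<union> W) C"
      using wlp_space_tensor_factor[OF disj(2) fin Z(1) VY assms(2) A Z(3) spT(1) sat r] by blast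
    \<comment> \<open>C depends on r and is a postcondition of P; minimality of sp puts u into
      it.\<close>
    have "psub (V \<union> W) (sp S V W P) C" using spW(2)[OF C(1)] C(3) by blast
    then show "tvec (V \<union> W) Z u r \<in> rng (V \<union> W \<union> Z) T" using u C(2) by (auto simp: psub_def)
  qed
  ultimately show ?thesis
    using spT(1) N unfolding T_def by (intro psub_antisym[of "V \<union> W \<union> Z"]) auto
qed

theorem theorem5p6:
  fixes V W :: "nat set" and S :: "sop set" and P Q :: op
  assumes "finite V" and "NProg V S" and "finite W"
    and "proj W P" and "proj W Q"
  shows
    \<comment> \<open>(1)\<close>
    "psub (V \<union> W) (sp S V (V \<union> W) (wlp S V W Q)) (ext W (V \<union> W) Q)
     \<and> psub (V \<union> W) (ext W (V \<union> W) P) (wlp S V (V \<union> W) (sp S V W P))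
    \<comment> \<open>(2)\<close>
     \<and> wp S V W Q = pmeet (V \<union> W) (wlp S V W Q) (wp S V W (idop W))
    \<comment> \<open>(3)\<close>
     \<and> wp S V W zop = zop \<and> sp S V W zop = zop
     \<and> wlp S V W (idop W) = ext W (V \<union> W) (idop W)
    \<comment> \<open>(4)\<close>
     \<and> (psub W P Q \<longrightarrow>
          (\<forall>xp \<in> {wp S V, wlp S V}. psub (V \<union> W) (xp W P) (xp W Q))
          \<and> psub (V \<union> W) (sp S V W P) (sp S V W Q))
    \<comment> \<open>(5)\<close>
     \<and> (\<forall>xp \<in> {wp S V, wlp S V}.
          xp W (pmeet W P Q) = pmeet (V \<union> W) (xp W P) (xp W Q))
    \<comment> \<open>(6)\<close>
     \<and> psub (V \<union> W) (sp S V W (pmeet W P Q)) (pmeet (V \<union> W) (sp S V W P) (sp S V W Q))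
    \<comment> \<open>(7)\<close>
     \<and> (\<forall>xp \<in> {wp S V, wlp S V}.
          psub (V \<union> W) (pjoin (V \<union> W) (xp W P) (xp W Q)) (xp W (pjoin W P Q)))
    \<comment> \<open>(8)\<close>
     \<and> pjoin (V \<union> W) (sp S V W P) (sp S V W Q) = sp S V W (pjoin W P Q)
    \<comment> \<open>(9)\<close>
     \<and> (\<forall>W' R. finite W' \<and> W' \<inter> (V \<union> W) = {} \<and> proj W' R \<longrightarrow>
          wp S V (W \<union> W') (tensor W W' Q R) = tensor (V \<union> W) W' (wp S V W Q) R
          \<and> sp S V (W \<union> W') (tensor W W' P R) = tensor (V \<union> W) W' (sp S V W P) R
          \<and> psub (V \<union> W \<union> W') (tensor (V \<union> W) W' (wlp S V W Q) R)
                               (wlp S V (W \<union> W') (tensor W W' Q R)))"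
proof -
  define Y where "Y = V \<union> W"
  have Y: "finite Y" "V \<subseteq> Y" "W \<subseteq> Y" "V \<union> Y = Y" using assms by (auto simp: Y_def)
  note ax = assms(1,2)
  note wpP = wp_props[OF ax assms(3), folded Y_def]
  note wlpP = wlp_props[OF ax assms(3), folded Y_def]
  note spP = sp_props[OF ax assms(3), folded Y_def]
  \<comment> \<open>For the nested transformers in (1): the outer one acts on the register Y, which
    already contains V, so its result lives on Y again.\<close>
  note wlpY = wlp_props[OF ax Y(1), unfolded Y(4)]
  note spY = sp_props[OF ax Y(1), unfolded Y(4)]
  note projE = proj_ext[OF Y(1,3)]
  have I: "proj W (idop W)" using assms(3) by simp
  have eI: "ext W Y (idop W) = idop Y" using Y by (simp add: ext_idop)
  have M: "proj W (pmeet W P Q)" "psub W (pmeet W P Q) P" "psub W (pmeet W P Q) Q"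
    using proj_pmeet[OF assms(3-5)] psub_pmeet_iff[OF assms(3-5), of "pmeet W P Q"] by simp_all
  have J: "proj W (pjoin W P Q)" by (rule proj_pjoin[OF assms(3-5)])
  have PJ: "psub W P (pjoin W P Q)" "psub W Q (pjoin W P Q)"
    using pjoin_psub_iff[OF assms(3-5) J] by simp_all
  have sp_le: "rng Y (ext W Y A) \<subseteq> wlp_space S V Y (sp S V W A)" if "proj W A" for A
    using spP(2)[OF that spP(1)[OF that]] by simp

  \<comment> \<open>Counit and unit of the adjunction between sp and wlp.\<close>
  have 1: "psub Y (sp S V Y (wlp S V W Q)) (ext W Y Q)"
    "psub Y (ext W Y P) (wlp S V Y (sp S V W P))"
  proof -
    have w: "proj Y (wlp S V W Q)" using wlpP assms(5) by blast
    show "psub Y (sp S V Y (wlp S V W Q)) (ext W Y Q)"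
      using spY(2)[OF w projE[OF assms(5)]] wlpP(2)[OF assms(5)] by (simp add: ext_self proj_is_op w)
    have s: "proj Y (sp S V W P)" using spP assms(4) by blast
    show "psub Y (ext W Y P) (wlp S V Y (sp S V W P))"
      using sp_le[OF assms(4)] wlpY(2)[OF s] by (simp add: ext_self proj_is_op s psub_def)
  qed
  \<comment> \<open>The second factor does not depend on A, so monotonicity and meets for wp follow
    from those for wlp.\<close>
  have wp_rng: "rng Y (wp S V W A) = rng Y (wlp S V W A) \<inter> rng Y (wp S V W (idop W))" if "proj W A" for A
    using wp_space_eq[OF Y(1,2) ax(2) projE[OF that]] wpP(2)[OF that] wpP(2)[OF I] wlpP(2)[OF that]
    by (simp add: eI)
  have 2: "wp S V W Q = pmeet Y (wlp S V W Q) (wp S V W (idop W))"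
    using wp_rng[OF assms(5)] wpP(1) wlpP(1) I assms(5) Y(1)
    by (intro proj_eqI[of Y]) (auto simp: proj_pmeet rng_pmeet)
  have 3: "wp S V W zop = zop" "sp S V W zop = zop" "wlp S V W (idop W) = ext W Y (idop W)"
  proof -
    \<comment> \<open>A single program suffices: its dual sends 0 to 0, so only the zero vector is
      fixed.\<close>
    obtain E where E: "E \<in> S" using ax(2) by (auto simp: NProg_def)
    have "wp_space S V Y zop = {\<lambda>_. 0}"
      using E by (auto simp: wp_space_def sext_dual_zop is_vec_def)
    then show "wp S V W zop = zop"
      using wpP[OF proj_zop] by (intro proj_eqI[of Y]) (simp_all add: ext_zop)
    have "rng Y zop \<subseteq> wlp_space S V Y zop" using subsp_wlp_space[of Y S V zop] by (simp add: subsp_def)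
    then have "psub Y (sp S V W zop) zop"
      using spP(2)[OF proj_zop, of zop] by (simp add: ext_zop)
    moreover have "psub Y zop (sp S V W zop)"
      using subsp_rng[OF spP(1)[OF proj_zop]] by (simp add: psub_def subsp_def)
    ultimately show "sp S V W zop = zop" using spP(1)[OF proj_zop] by (intro psub_antisym[of Y]) auto
    have z: "idop Y - idop Y = zop" by (simp add: zop_def fun_eq_iff)
    have "wlp_space S V Y (idop Y) = {v. is_vec Y v}"
      by (simp add: wlp_space_def z sext_dual_zop)
    then show "wlp S V W (idop W) = ext W Y (idop W)"
      using wlpP[OF I] Y(1) by (intro proj_eqI[of Y]) (simp_all add: eI rng_idop)
  qed
  have mono_wlp: "psub Y (wlp S V W A) (wlp S V W C)" if "proj W A" "proj W C" "psub W A C" for A C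
    using wlp_space_mono[OF Y(1,2) ax(2) projE[OF that(1)] projE[OF that(2)] ext_mono[OF Y(1,3) that]]
    by (simp add: psub_def wlpP(2) that)
  have mono_wp: "psub Y (wp S V W A) (wp S V W C)" if "proj W A" "proj W C" "psub W A C" for A C
    using mono_wlp[OF that] unfolding psub_def wp_rng[OF that(1)] wp_rng[OF that(2)] by blast
  have mono_sp: "psub Y (sp S V W A) (sp S V W C)" if "proj W A" "proj W C" "psub W A C" for A C
    using sp_le[OF that(2)] ext_mono[OF Y(1,3) that] spP(2)[OF that(1) spP(1)[OF that(2)]]
    by (simp add: psub_def)
  have 5: "wlp S V W (pmeet W P Q) = pmeet Y (wlp S V W P) (wlp S V W Q)"
    "wp S V W (pmeet W P Q) = pmeet Y (wp S V W P) (wp S V W Q)"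
  proof -
    have wlp: "rng Y (wlp S V W (pmeet W P Q)) = rng Y (wlp S V W P) \<inter> rng Y (wlp S V W Q)"
      using wlp_space_pmeet[OF Y(1,2) ax(2) projE[OF assms(4)] projE[OF assms(5)]]
      by (simp add: wlpP(2) M(1) assms(4,5) ext_pmeet[OF Y(1,3) assms(4,5)])
    then show "wlp S V W (pmeet W P Q) = pmeet Y (wlp S V W P) (wlp S V W Q)"
      using wlpP(1) M(1) assms(4,5) Y(1) by (intro proj_eqI[of Y]) (auto simp: proj_pmeet rng_pmeet)
    have "rng Y (wp S V W (pmeet W P Q)) = rng Y (wp S V W P) \<inter> rng Y (wp S V W Q)"
      unfolding wp_rng[OF M(1)] wp_rng[OF assms(4)] wp_rng[OF assms(5)] wlp by blast
    then show "wp S V W (pmeet W P Q) = pmeet Y (wp S V W P) (wp S V W Q)"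
      using wpP(1) M(1) assms(4,5) Y(1) by (intro proj_eqI[of Y]) (auto simp: proj_pmeet rng_pmeet)
  qed
  have 6: "psub Y (sp S V W (pmeet W P Q)) (pmeet Y (sp S V W P) (sp S V W Q))"
    using mono_sp[OF M(1) assms(4) M(2)] mono_sp[OF M(1) assms(5) M(3)] spP(1) assms(4,5) Y(1)
    by (simp add: psub_pmeet_iff)
  have 7: "psub Y (pjoin Y (wlp S V W P) (wlp S V W Q)) (wlp S V W (pjoin W P Q))"
    "psub Y (pjoin Y (wp S V W P) (wp S V W Q)) (wp S V W (pjoin W P Q))"
    using mono_wlp[OF assms(4) J PJ(1)] mono_wlp[OF assms(5) J PJ(2)]
      mono_wp[OF assms(4) J PJ(1)] mono_wp[OF assms(5) J PJ(2)] wlpP(1) wpP(1) J assms(4,5) Y(1)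
    by (simp_all add: pjoin_psub_iff)
  have 8: "pjoin Y (sp S V W P) (sp S V W Q) = sp S V W (pjoin W P Q)"
  proof (rule psub_antisym[of Y])
    have j: "proj Y (pjoin Y (sp S V W P) (sp S V W Q))" 
      by (rule proj_pjoin[OF Y(1) spP(1)[OF assms(4)] spP(1)[OF assms(5)]])
    show "proj Y (pjoin Y (sp S V W P) (sp S V W Q))" "proj Y (sp S V W (pjoin W P Q))"
      using j spP(1) J by auto
    show "psub Y (pjoin Y (sp S V W P) (sp S V W Q)) (sp S V W (pjoin W P Q))"
      using mono_sp[OF assms(4) J PJ(1)] mono_sp[OF assms(5) J PJ(2)] spP(1) J assms(4,5) Y(1)
      by (simp add: pjoin_psub_iff)
    let ?K = "wlp_space S V Y (pjoin Y (sp S V W P) (sp S V W Q))"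
    have "psub Y (sp S V W P) (pjoin Y (sp S V W P) (sp S V W Q))"
      "psub Y (sp S V W Q) (pjoin Y (sp S V W P) (sp S V W Q))"
      using pjoin_psub_iff[OF Y(1) spP(1)[OF assms(4)] spP(1)[OF assms(5)] j] by simp_all
    then have "rng Y (ext W Y P) \<subseteq> ?K" "rng Y (ext W Y Q) \<subseteq> ?K"
      using spP(2)[OF assms(4) j] spP(2)[OF assms(5) j] by auto
    \<comment> \<open>The admissible preconditions of a fixed postcondition form a subspace, so
      containing the ranges of P and Q it contains their span.\<close>
    then have "rng Y (ext W Y (pjoin W P Q)) \<subseteq> ?K"
      using vspan_minimal[OF subsp_wlp_space, of "rng Y (ext W Y P) \<union> rng Y (ext W Y Q)"]
      by (simp add: ext_pjoin Y assms rng_pjoin projE)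
    then show "psub Y (sp S V W (pjoin W P Q)) (pjoin Y (sp S V W P) (sp S V W Q))"
      using spP(2)[OF J j] by simp
  qed
  show ?thesis
    using 1 2 3 5 6 7 8 mono_wp[OF assms(4,5)] mono_wlp[OF assms(4,5)] mono_sp[OF assms(4,5)]
      wp_tensor[OF ax assms(3,5)] sp_tensor[OF ax assms(3,4)] wlp_tensor[OF ax assms(3,5)]
    unfolding Y_def[symmetric] by (intro conjI allI impI ballI) auto
qed

end
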